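(* Let $k$ and $n$ be integers with $k\geq 2$, $kn\equiv 0 \pmod 2$ and $n\geq\max\{k^{2}+6k+7,\,20k+10\}$. Let $G$ be a graph of order $n$ with minimum degree $\delta(G)\geq k$. If $\rho(G)\geq\rho(G_{n,k})$, then $G$ has a $k$-factor, unless $G=G_{n,k}$ (up to isomorphism).
   Context: All graphs are finite, undirected and simple. The spectral radius $\rho(G)$ of a graph $G$ is the largest eigenvalue of its adjacency matrix. A $k$-factor of $G$ is a $k$-regular spanning subgraph of $G$. $K_m$ is the complete graph of order $m$, $\overline{H}$ is the complement of $H$, $G_1\cup G_2$ is the disjoint union of vertex-disjoint graphs, and the join $G_1\vee G_2$ is obtained from $G_1\cup G_2$ by joining every vertex of $G_1$ to every vertex of $G_2$. For $k\geq 2$ and $n\geq 3k$, $G_{n,k}$ denotes the graph of order $n$ obtained from $K_{k}\vee(\overline{K_{k+1}}\cup K_{n-1-2k})$ by connecting one vertex of $V(\overline{K_{k+1}})$ to $k-1$ vertices of $V(K_{n-1-2k})$. *)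

theory Defs
  imports
    "Graph_Theory.Graph_Theory"
    "Jordan_Normal_Form.Spectral_Radius"
begin

text \<open>
  A finite simple undirected graph is a \<^typ>\<open>'a pair_pre_digraph\<close> satisfying
  \<^locale>\<open>pair_graph\<close>: the vertex set is finite and the arc set is an irreflexive symmetric
  relation on it, so that an edge \<open>uv\<close> is the pair of arcs \<open>(u, v)\<close>, \<open>(v, u)\<close>. Hence the degree
  of a vertex is its \<^const>\<open>out_degree\<close>.
\<close>

definition min_degree :: "'a pair_pre_digraph \<Rightarrow> nat" where
  "min_degree G = Min (out_degree G ` pverts G)"

definition regular_graph :: "nat \<Rightarrow> 'a pair_pre_digraph \<Rightarrow> bool" where
  "regular_graph k G \<longleftrightarrow> pair_graph G \<and> (\<forall>v\<in>pverts G. out_degree G v = k)"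

definition is_factor :: "nat \<Rightarrow> 'a pair_pre_digraph \<Rightarrow> 'a pair_pre_digraph \<Rightarrow> bool" where
  "is_factor k H G \<longleftrightarrow> regular_graph k H \<and> spanning H G"


subsection \<open>Spectral radius\<close>

definition adjacency_mat :: "'a pair_pre_digraph \<Rightarrow> 'a list \<Rightarrow> real mat" where
  "adjacency_mat G vs = mat (length vs) (length vs) (\<lambda>(i, j). if (vs ! i, vs ! j) \<in> parcs G then 1 else 0)"

text \<open>
  Matrices are indexed by natural numbers, so the vertices have to be listed in some order. The
  lemma \<open>eigenvalue_adjacency_mat_iff\<close> below shows that the eigenvalues do not depend on that order.
  They are taken over the reals, which loses nothing since the adjacency matrix is real symmetric.
\<close>

definition graph_spectral_radius :: "'a pair_pre_digraph \<Rightarrow> real" where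
  "graph_spectral_radius G =
     Max (spectrum (adjacency_mat G (SOME vs. distinct vs \<and> set vs = pverts G)))"

lemma eigenvalue_adjacency_mat_iff:
  assumes vs: "distinct vs" "set vs = pverts G"
  shows "eigenvalue (adjacency_mat G vs) l \<longleftrightarrow>
    (\<exists>f. (\<exists>v\<in>pverts G. f v \<noteq> 0) \<and>
         (\<forall>u\<in>pverts G. (\<Sum>v | v \<in> pverts G \<and> (u, v) \<in> parcs G. f v) = l * f u))"
    (is "?L \<longleftrightarrow> ?R")
proof -
  define n where "n = length vs"
  have bij: "bij_betw ((!) vs) {0..<n} (pverts G)"
    using bij_betw_nth[OF vs(1), of "{..<length vs}" "set vs"] vs
    by (simp add: n_def atLeast0LessThan)
  have fin: "finite (pverts G)" using vs(2) by (metis List.finite_set)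
  have row: "(adjacency_mat G vs *\<^sub>v x) $ i =
      (\<Sum>v | v \<in> pverts G \<and> (vs ! i, v) \<in> parcs G. f v)"
    if i: "i < n" and x: "x \<in> carrier_vec n" and f: "\<And>j. j < n \<Longrightarrow> f (vs ! j) = x $ j" for x f i
  proof -
    have "(adjacency_mat G vs *\<^sub>v x) $ i = (\<Sum>j\<in>{0..<n}. (if (vs ! i, vs ! j) \<in> parcs G then 1 else 0) * x $ j)"
      using i x by (auto simp: adjacency_mat_def n_def scalar_prod_def intro!: sum.cong)
    also have "\<dots> = (\<Sum>j\<in>{0..<n}. if (vs ! i, vs ! j) \<in> parcs G then f (vs ! j) else 0)"
      using f by (intro sum.cong) auto
    also have "\<dots> = (\<Sum>v\<in>pverts G. if (vs ! i, v) \<in> parcs G then f v else 0)"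
      using sum.reindex_bij_betw[OF bij, of "\<lambda>v. if (vs ! i, v) \<in> parcs G then f v else 0"] by simp
    also have "\<dots> = (\<Sum>v | v \<in> pverts G \<and> (vs ! i, v) \<in> parcs G. f v)"
      using fin by (simp add: sum.If_cases Int_def)
    finally show ?thesis .
  qed
  have dim: "dim_row (adjacency_mat G vs) = n" by (simp add: adjacency_mat_def n_def)
  have mem: "vs ! i \<in> pverts G" if "i < n" for i using that nth_mem[of i vs] unfolding n_def vs(2) by blast
  have idx: "\<exists>i<n. vs ! i = u" if "u \<in> pverts G" for u
    using that unfolding vs(2)[symmetric] n_def in_set_conv_nth by blast
  show ?thesis
  proof
    assume ?L
    then obtain x where x: "x \<in> carrier_vec n" "x \<noteq> 0\<^sub>v n" "adjacency_mat G vs *\<^sub>v x = l \<cdot>\<^sub>v x"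
      unfolding eigenvalue_def eigenvector_def dim by blast
    define f where "f = (\<lambda>v. x $ (the_inv_into {0..<n} ((!) vs) v))"
    have f: "f (vs ! j) = x $ j" if "j < n" for j
      using that bij unfolding f_def bij_betw_def by (simp add: the_inv_into_f_f)
    obtain j where "j < n" "x $ j \<noteq> 0"
      using x(1,2) by (metis carrier_vecD eq_vecI index_zero_vec(1,2))
    then have "\<exists>v\<in>pverts G. f v \<noteq> 0" using f mem by metis
    moreover have "(\<Sum>v | v \<in> pverts G \<and> (u, v) \<in> parcs G. f v) = l * f u"
      if u: "u \<in> pverts G" for u
    proof -
      obtain i where i: "i < n" "vs ! i = u" using idx[OF u] by blast
      show ?thesis using row[OF i(1) x(1) f] x(1,3) i f[OF i(1)] by auto
    qed
    ultimately show ?R by blast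
  next
    assume ?R
    then obtain f where f: "\<exists>v\<in>pverts G. f v \<noteq> 0"
      "\<And>u. u \<in> pverts G \<Longrightarrow> (\<Sum>v | v \<in> pverts G \<and> (u, v) \<in> parcs G. f v) = l * f u" by blast
    define x where "x = vec n (\<lambda>i. f (vs ! i))"
    have x: "x \<in> carrier_vec n" by (simp add: x_def)
    obtain j where "j < n" "f (vs ! j) \<noteq> 0" using f(1) idx by metis
    then have "x \<noteq> 0\<^sub>v n" unfolding x_def by (metis index_vec index_zero_vec(1))
    moreover have "adjacency_mat G vs *\<^sub>v x = l \<cdot>\<^sub>v x"
    proof (rule eq_vecI)
      fix i assume "i < dim_vec (l \<cdot>\<^sub>v x)"
      then have i: "i < n" by (simp add: x_def)
      show "(adjacency_mat G vs *\<^sub>v x) $ i = (l \<cdot>\<^sub>v x) $ i"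
        using row[OF i x, of f] f(2)[OF mem[OF i]] i by (simp add: x_def)
    qed (simp add: x_def dim)
    ultimately show ?L unfolding eigenvalue_def eigenvector_def dim using x by blast
  qed
qed


subsection \<open>The extremal graph\<close>

definition complete_graph :: "'a set \<Rightarrow> 'a pair_pre_digraph" where
  "complete_graph V = \<lparr>pverts = V, parcs = {(u, v). u \<in> V \<and> v \<in> V \<and> u \<noteq> v}\<rparr>"

definition graph_complement :: "'a pair_pre_digraph \<Rightarrow> 'a pair_pre_digraph" where
  "graph_complement G =
     \<lparr>pverts = pverts G,
      parcs = {(u, v). u \<in> pverts G \<and> v \<in> pverts G \<and> u \<noteq> v \<and> (u, v) \<notin> parcs G}\<rparr>"

text \<open>The next two operations are only meant for graphs with disjoint vertex sets.\<close>

definition graph_union :: "'a pair_pre_digraph \<Rightarrow> 'a pair_pre_digraph \<Rightarrow> 'a pair_pre_digraph" where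
  "graph_union G H = \<lparr>pverts = pverts G \<union> pverts H, parcs = parcs G \<union> parcs H\<rparr>"

definition graph_join :: "'a pair_pre_digraph \<Rightarrow> 'a pair_pre_digraph \<Rightarrow> 'a pair_pre_digraph" where
  "graph_join G H =
     \<lparr>pverts = pverts G \<union> pverts H,
      parcs = parcs (graph_union G H) \<union> pverts G \<times> pverts H \<union> pverts H \<times> pverts G\<rparr>"

definition connect_to :: "'a \<Rightarrow> 'a set \<Rightarrow> 'a pair_pre_digraph \<Rightarrow> 'a pair_pre_digraph" where
  "connect_to u W G = \<lparr>pverts = pverts G, parcs = parcs G \<union> {u} \<times> W \<union> W \<times> {u}\<rparr>"

text \<open>
  A representative of the isomorphism class of \<open>G\<^sub>n\<^sub>,\<^sub>k\<close> with vertices \<open>0, \<dots>, n - 1\<close>: the first \<open>k\<close>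
  vertices form \<open>K\<^sub>k\<close>, the next \<open>k + 1\<close> are the independent ones and the remaining \<open>n - 1 - 2 * k\<close>
  form a clique. The independent vertex \<open>k\<close> is connected to the first \<open>k - 1\<close> vertices of that
  clique, which has enough vertices because \<open>n \<ge> 3 * k\<close>.
\<close>

definition extremal_graph :: "nat \<Rightarrow> nat \<Rightarrow> nat pair_pre_digraph" where
  "extremal_graph n k =
     connect_to k {2 * k + 1..<3 * k}
       (graph_join (complete_graph {0..<k})
          (graph_union (graph_complement (complete_graph {k..<2 * k + 1}))
                       (complete_graph {2 * k + 1..<n})))"

lemma extremal_graph_wf:
  assumes "2 \<le> k" "3 * k \<le> n"
  shows "pair_graph (extremal_graph n k)" and "pverts (extremal_graph n k) = {0..<n}"
proof -
  show V: "pverts (extremal_graph n k) = {0..<n}"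
    using assms by (auto simp: extremal_graph_def connect_to_def graph_join_def graph_union_def
      graph_complement_def complete_graph_def)
  have A: "parcs (extremal_graph n k) \<subseteq> {0..<n} \<times> {0..<n}"
    using assms by (auto simp: extremal_graph_def connect_to_def graph_join_def graph_union_def
      graph_complement_def complete_graph_def)
  show "pair_graph (extremal_graph n k)"
  proof
    show "finite (parcs (extremal_graph n k))" using A by (rule finite_subset) simp
    show "symmetric (extremal_graph n k)"
      by (auto simp: symmetric_def sym_def extremal_graph_def connect_to_def graph_join_def
        graph_union_def graph_complement_def complete_graph_def)
  next
    fix e assume "e \<in> parcs (extremal_graph n k)"
    then show "fst e \<noteq> snd e"
      by (auto simp: extremal_graph_def connect_to_def graph_join_def
        graph_union_def graph_complement_def complete_graph_def)
  qed (use A V in auto)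
qed

end

theory Submission
  imports Defs "HOL-Analysis.Function_Topology"
begin

text \<open>
  Let \<open>x\<close> be a nonnegative eigenvector for \<open>\<rho> = \<rho>(G)\<close>, scaled to maximum \<open>1\<close>. The eigenvalue equation at
  a maximal entry and \<open>\<rho> \<ge> n - k - 2\<close> give \<open>\<Sum>\<^sub>v (1 - x\<^sub>v) \<le> k + 1\<close>, while \<open>\<rho> x\<^sub>v \<le> d(v)\<close>. Hence few vertices
  have small degree, and the set \<open>L\<close> of the vertices of degree at most \<open>4 k\<close> has at most \<open>k + 1\<close>
  elements. Suppose that one can select \<open>k\<close> edges at every vertex of \<open>L\<close>, keeping all edges inside \<open>L\<close>,
  such that no vertex outside \<open>L\<close> is selected more than \<open>k\<close> times. Then the selection extends to a
  \<open>k\<close>-factor, because \<open>G - L\<close> is dense enough for edge exchanges. The selection fails only if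
  \<open>|L| = k + 1\<close> and the total excess \<open>\<Sum>\<^sub>L (d(v) - k)\<close> is less than the number, at most \<open>k\<close>, of common
  neighbours of \<open>L\<close> outside \<open>L\<close>. If a single vertex of \<open>L\<close> carries an excess of \<open>k - 1\<close>, then \<open>G\<close> is a
  spanning subgraph of the extremal graph. Otherwise the sum of the squares \<open>(\<rho> x\<^sub>v)\<^sup>2\<close> over \<open>L\<close> is
  smaller than in the extremal graph built on the largest entries of \<open>x\<close>, which therefore has a larger
  spectral radius.
\<close>

subsection \<open>Factors by edge exchange\<close>

lemma sum_arcs:
  fixes g :: "'a \<Rightarrow> 'a \<Rightarrow> 'b::comm_monoid_add"
  assumes "finite V" "E \<subseteq> V \<times> V"
  shows "(\<Sum>(u, v)\<in>E. g u v) = (\<Sum>u\<in>V. \<Sum>v\<in>E `` {u}. g u v)"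
proof -
  have "finite (E `` {u})" for u
    using assms by (meson finite_Image finite_SigmaI finite_subset)
  then have "(\<Sum>u\<in>V. \<Sum>v\<in>E `` {u}. g u v) = (\<Sum>(u, v)\<in>Sigma V (\<lambda>u. E `` {u}). g u v)"
    using assms by (intro sum.Sigma) auto
  moreover have "Sigma V (\<lambda>u. E `` {u}) = E"
    using assms by auto
  ultimately show ?thesis by simp
qed

lemma card_arcs:
  assumes "finite V" "E \<subseteq> V \<times> V"
  shows "card E = (\<Sum>u\<in>V. card (E `` {u}))"
  using sum_arcs[OF assms, of "\<lambda>_ _. 1::nat"] by simp

definition ins_edge :: "'a \<Rightarrow> 'a \<Rightarrow> ('a \<times> 'a) set \<Rightarrow> ('a \<times> 'a) set" where
  "ins_edge x y H = H \<union> {(x, y), (y, x)}"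

definition del_edge :: "'a \<Rightarrow> 'a \<Rightarrow> ('a \<times> 'a) set \<Rightarrow> ('a \<times> 'a) set" where
  "del_edge x y H = H - {(x, y), (y, x)}"

lemma sym_ins_edge: "sym H \<Longrightarrow> sym (ins_edge x y H)"
  and sym_del_edge: "sym H \<Longrightarrow> sym (del_edge x y H)"
  by (auto simp: ins_edge_def del_edge_def sym_def)

lemma ins_edge_iff: "(a, b) \<in> ins_edge x y H \<longleftrightarrow> (a, b) \<in> H \<or> (a = x \<and> b = y) \<or> (a = y \<and> b = x)"
  and del_edge_iff: "(a, b) \<in> del_edge x y H \<longleftrightarrow> (a, b) \<in> H \<and> \<not> (a = x \<and> b = y) \<and> \<not> (a = y \<and> b = x)"
  by (auto simp: ins_edge_def del_edge_def)

lemma finite_ins_edge: "finite H \<Longrightarrow> finite (ins_edge x y H)"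
  and finite_del_edge: "finite H \<Longrightarrow> finite (del_edge x y H)"
  by (auto simp: ins_edge_def del_edge_def)

lemma degree_ins_edge:
  assumes "finite H" "sym H" "x \<noteq> y" "(x, y) \<notin> H"
  shows "card (ins_edge x y H `` {v}) = card (H `` {v}) + (if v = x \<or> v = y then 1 else 0)"
proof -
  have "finite (H `` {u})" for u using assms(1) by (rule finite_Image)
  moreover have "(y, x) \<notin> H" using assms by (meson symD)
  moreover have "ins_edge x y H `` {x} = insert y (H `` {x})" "ins_edge x y H `` {y} = insert x (H `` {y})"
    "v \<noteq> x \<Longrightarrow> v \<noteq> y \<Longrightarrow> ins_edge x y H `` {v} = H `` {v}"
    using assms by (auto simp: ins_edge_def)
  ultimately show ?thesis using assms by auto
qed

lemma sum_ins_edge: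
  assumes "finite H" "sym H" "x \<noteq> y" "(x, y) \<notin> H"
  shows "sum g (ins_edge x y H) = sum g H + g (x, y) + (g (y, x) :: nat)"
proof -
  have "(y, x) \<notin> H" using assms by (meson symD)
  moreover have "ins_edge x y H = insert (x, y) (insert (y, x) H)" by (auto simp: ins_edge_def)
  ultimately show ?thesis using assms by simp
qed

lemma ins_del_edge: "sym H \<Longrightarrow> (x, y) \<in> H \<Longrightarrow> ins_edge x y (del_edge x y H) = H"
  by (auto simp: ins_edge_def del_edge_def sym_def)

lemma
  assumes "finite H" "sym H" "x \<noteq> y" "(x, y) \<in> H"
  shows degree_del_edge: "card (H `` {v}) = card (del_edge x y H `` {v}) + (if v = x \<or> v = y then 1 else 0)"
    and sum_del_edge: "sum g H = sum g (del_edge x y H) + g (x, y) + (g (y, x) :: nat)"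
  using degree_ins_edge[of "del_edge x y H" x y v] sum_ins_edge[of "del_edge x y H" x y g] assms
  by (simp_all add: ins_del_edge sym_del_edge finite_del_edge del_edge_iff)

text \<open>Reversal pairs up the arcs without fixed points, so deleting one edge removes exactly
  two of them. With \<open>card_arcs\<close> this is the handshake lemma modulo 2.\<close>

lemma even_card_symmetric:
  assumes "finite H" "sym H" "irrefl H"
  shows "even (card H)"
  using assms
proof (induction "card H" arbitrary: H rule: less_induct)
  case less
  show ?case
  proof (cases "H = {}")
    case False
    then obtain x y where xy: "(x, y) \<in> H" by auto
    then have "x \<noteq> y" using less.prems(3) by (auto simp: irrefl_def)
    from sum_del_edge[OF less.prems(1,2) this xy, of "\<lambda>_. 1"]
    have c: "card H = card (del_edge x y H) + 2" by simp
    have "even (card (del_edge x y H))"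
      using less.prems c by (intro less.hyps) (auto simp: finite_del_edge sym_del_edge, auto simp: irrefl_def del_edge_def)
    then show ?thesis using c by simp
  qed simp
qed

text \<open>Double counting of the arcs leaving \<open>A\<close>: reversed, they all leave vertices
  of the image of \<open>A\<close>, each of degree at most \<open>k\<close>. The degrees missing in
  \<open>A\<close> account for at most \<open>k * t\<close> arcs, the capacity of \<open>t\<close>
  vertices.\<close>

lemma card_le_card_Image:
  assumes V: "finite V" and H: "H \<subseteq> V \<times> V" "sym H" and A: "A \<subseteq> V"
    and k: "0 < k" "\<And>v. v \<in> V \<Longrightarrow> card (H `` {v}) \<le> k"
    and deficit: "(\<Sum>v\<in>A. k - card (H `` {v})) \<le> k * t"
  shows "card A \<le> card (H `` A) + t"
proof -
  have finH: "finite H" using V H by (meson finite_SigmaI finite_subset)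
  have fA: "finite A" using V A finite_subset by auto
  have fin: "finite (H `` B)" for B using finH by (rule finite_Image)
  have "k * card A = (\<Sum>v\<in>A. card (H `` {v}) + (k - card (H `` {v})))"
    using k(2) A by (simp add: subset_iff)
  also have "\<dots> = (\<Sum>v\<in>A. card (H `` {v})) + (\<Sum>v\<in>A. k - card (H `` {v}))"
    by (rule sum.distrib)
  also have "(\<Sum>v\<in>A. card (H `` {v})) = card (Sigma A (\<lambda>v. H `` {v}))"
    using fA fin by simp
  also have "\<dots> \<le> card (Sigma (H `` A) (\<lambda>v. H `` {v}))"
  proof (rule card_inj_on_le[where f = prod.swap])
    show "prod.swap ` Sigma A (\<lambda>v. H `` {v}) \<subseteq> Sigma (H `` A) (\<lambda>v. H `` {v})"
      using H(2) by (auto simp: sym_def)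
    show "finite (Sigma (H `` A) (\<lambda>v. H `` {v}))" using fin by simp
  qed auto
  also have "\<dots> = (\<Sum>v\<in>H `` A. card (H `` {v}))" using fin by simp
  also have "\<dots> \<le> (\<Sum>v\<in>H `` A. k)" using H k(2) by (intro sum_mono) auto
  finally have "k * card A \<le> k * (card (H `` A) + t)"
    using deficit by (simp add: algebra_simps)
  then show ?thesis using k(1) by simp
qed

text \<open>
  Take \<open>H\<close> with as many edges as possible and, among those, with its degrees concentrated on vertices
  of small \<open>\<phi>\<close>. If \<open>u\<close> has not reached \<open>f u\<close>, all its remaining neighbours \<open>a\<close> have reached \<open>f a\<close>,
  and an edge \<open>a w\<close> of \<open>H\<close> can be exchanged for \<open>u a\<close>, which moves the deficiency to \<open>w\<close>. There are
  many such \<open>w\<close>, so \<open>\<phi> u\<close> is large. Two deficient vertices of large degree can then be repaired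
  simultaneously by exchanging an edge \<open>x y\<close> of \<open>H\<close> for \<open>u x\<close> and \<open>v y\<close>.
\<close>

lemma f_factor_of_large_degrees:
  fixes f \<phi> :: "'a \<Rightarrow> nat"
  assumes V: "finite V" and E: "E \<subseteq> V \<times> V" "sym E" "irrefl E"
    and k: "0 < k" and fk: "\<And>v. v \<in> V \<Longrightarrow> f v \<le> k"
    and deficit: "(\<Sum>v\<in>V. k - f v) \<le> k * t" and ev: "even (\<Sum>v\<in>V. f v)"
    and deg: "\<And>u. u \<in> V \<Longrightarrow> card {w \<in> V. \<phi> w \<le> \<phi> u} + k + t \<le> card (E `` {u}) \<or>
      card V + t + 2 * k \<le> 2 * card (E `` {u}) + 1"
  shows "\<exists>H\<subseteq>E. sym H \<and> (\<forall>v\<in>V. card (H `` {v}) = f v)"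
proof -
  have finE: "finite E" using V E by (meson finite_SigmaI finite_subset)
  define P where "P H \<longleftrightarrow> H \<subseteq> E \<and> sym H \<and> (\<forall>v\<in>V. card (H `` {v}) \<le> f v)" for H
  \<comment> \<open>Counts \<open>\<phi> v\<close> once for every edge at \<open>v\<close>.
    Exchanging an edge \<open>a w\<close> for \<open>u a\<close> therefore changes
    \<open>\<Phi>\<close> by \<open>\<phi> u - \<phi> w\<close>.\<close>
  define \<Phi> where "\<Phi> H = (\<Sum>e\<in>H. \<phi> (fst e))" for H :: "('a \<times> 'a) set"
  have "P {}" by (auto simp: P_def sym_def)
  moreover have "card H \<le> card E" if "P H" for H using that finE by (auto simp: P_def intro: card_mono)
  ultimately obtain H0 where H0: "P H0" "\<And>H. P H \<Longrightarrow> card H \<le> card H0"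
    using ex_has_greatest_nat[of P "{}" card "card E + 1"] by (metis less_Suc_eq_le Suc_eq_plus1)
  obtain H where H: "P H" "card H = card H0"
    and \<Phi>min: "\<And>H'. P H' \<and> card H' = card H0 \<Longrightarrow> \<Phi> H \<le> \<Phi> H'"
    using ex_has_least_nat[of "\<lambda>H. P H \<and> card H = card H0" H0 \<Phi>] H0 by blast
  have max: "card H' \<le> card H" if "P H'" for H' using H0(2)[OF that] H(2) by simp
  have HE: "H \<subseteq> E" "sym H" "\<And>v. v \<in> V \<Longrightarrow> card (H `` {v}) \<le> f v" using H(1) by (auto simp: P_def)
  have HV: "H \<subseteq> V \<times> V" using HE E by auto
  have irr: "irrefl H" using HE(1) E(3) by (auto simp: irrefl_def)
  have finH: "finite H" using HE(1) finE finite_subset by auto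
  define A where "A u = E `` {u} - H `` {u}" for u
  have AV: "A u \<subseteq> V" for u using E by (auto simp: A_def)
  have finHu: "finite (H `` {u})" for u using finH by (rule finite_Image)
  \<comment> \<open>Otherwise the edge \<open>u a\<close> could be added, against the maximality of
    \<open>H\<close>.\<close>
  have sat: "card (H `` {a}) = f a" if "u \<in> V" "card (H `` {u}) < f u" "a \<in> A u" for u a
  proof (rule ccontr)
    assume ne: "card (H `` {a}) \<noteq> f a"
    have a: "a \<in> V" "(u, a) \<in> E" "(a, u) \<in> E" "(u, a) \<notin> H" "u \<noteq> a"
      using that E unfolding A_def by (auto simp: sym_def irrefl_def)
    have "P (ins_edge u a H)"
      unfolding P_def
    proof (intro conjI ballI)
      show "ins_edge u a H \<subseteq> E" using a HE by (auto simp: ins_edge_def)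
      show "sym (ins_edge u a H)" using HE by (simp add: sym_ins_edge)
      fix v assume "v \<in> V"
      then show "card (ins_edge u a H `` {v}) \<le> f v"
        unfolding degree_ins_edge[OF finH HE(2) a(5,4)]
        using HE(3)[of v] HE(3)[OF a(1)] ne that(2) by auto
    qed
    from max[OF this] show False
      using sum_ins_edge[OF finH HE(2) a(5,4), of "\<lambda>_. 1"] by simp
  qed
  have cardA: "card (E `` {u}) + 1 \<le> card (A u) + k" if "u \<in> V" "card (H `` {u}) < f u" for u
  proof -
    have "H `` {u} \<subseteq> E `` {u}" using HE by auto
    then have "card (A u) = card (E `` {u}) - card (H `` {u})"
      unfolding A_def using finHu by (intro card_Diff_subset) auto
    then show ?thesis using that fk[OF that(1)] by linarith
  qed
  have cardW: "card (A u) \<le> card (H `` A u) + t" if "u \<in> V" "card (H `` {u}) < f u" for u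
  proof (rule card_le_card_Image[OF V HV HE(2) AV k])
    show "card (H `` {v}) \<le> k" if "v \<in> V" for v using HE(3)[OF that] fk[OF that] by simp
    have "(\<Sum>v\<in>A u. k - card (H `` {v})) = (\<Sum>v\<in>A u. k - f v)"
      using sat[OF that] by (intro sum.cong) auto
    also have "\<dots> \<le> (\<Sum>v\<in>V. k - f v)" using V AV by (intro sum_mono2) auto
    finally show "(\<Sum>v\<in>A u. k - card (H `` {v})) \<le> k * t" using deficit by simp
  qed
  have swap: "\<phi> w \<le> \<phi> u" if u: "u \<in> V" "card (H `` {u}) < f u" and w: "w \<in> H `` A u" for u w
  proof -
    obtain a where a: "a \<in> A u" "(a, w) \<in> H" using w by auto
    have a': "a \<in> V" "(u, a) \<in> E" "(a, u) \<in> E" "(u, a) \<notin> H" "u \<noteq> a" "a \<noteq> w" "u \<noteq> w" "w \<in> V"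
      using a u E HE HV irr unfolding A_def by (auto simp: sym_def irrefl_def)
    let ?D = "del_edge a w H"
    have D: "finite ?D" "sym ?D" "(u, a) \<notin> ?D"
      using finH HE a' by (auto simp: finite_del_edge sym_del_edge del_edge_iff)
    note dd = degree_del_edge[OF finH HE(2) a'(6) a(2)] sum_del_edge[OF finH HE(2) a'(6) a(2)]
    note di = degree_ins_edge[OF D(1,2) a'(5) D(3)] sum_ins_edge[OF D(1,2) a'(5) D(3)]
    have "P (ins_edge u a ?D)"
      unfolding P_def
    proof (intro conjI ballI)
      show "ins_edge u a ?D \<subseteq> E" using a' HE by (auto simp: ins_edge_def del_edge_def)
      show "sym (ins_edge u a ?D)" using D by (simp add: sym_ins_edge)
      fix v assume "v \<in> V"
      then show "card (ins_edge u a ?D `` {v}) \<le> f v"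
        unfolding di using dd(1)[of v] HE(3)[of v] u(2) a' by (auto split: if_splits)
    qed
    moreover have "card (ins_edge u a ?D) = card H"
      using dd(2)[of "\<lambda>_. 1"] di(2)[of "\<lambda>_. 1"] by simp
    ultimately have "\<Phi> H \<le> \<Phi> (ins_edge u a ?D)" using \<Phi>min H(2) by simp
    then show ?thesis
      using dd(2)[of "\<lambda>e. \<phi> (fst e)"] di(2)[of "\<lambda>e. \<phi> (fst e)"] unfolding \<Phi>_def by simp
  qed
  \<comment> \<open>The first alternative of \<open>deg\<close> is impossible at a deficient
    \<open>u\<close>: by \<open>swap\<close> the image of \<open>A u\<close> would be too small for
    the double counting in \<open>cardW\<close>.\<close>
  have big: "card V + t + 2 * k \<le> 2 * card (E `` {u}) + 1" if "u \<in> V" "card (H `` {u}) < f u" for u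
  proof -
    have "H `` A u \<subseteq> {w \<in> V. \<phi> w \<le> \<phi> u}" using swap[OF that] HV by auto
    then have "card (H `` A u) \<le> card {w \<in> V. \<phi> w \<le> \<phi> u}" using V by (intro card_mono) auto
    then show ?thesis using deg[OF that(1)] cardA[OF that] cardW[OF that] by linarith
  qed
  \<comment> \<open>The case \<open>u = v\<close> is included for a single vertex that lacks two
    edges; then both new edges are attached to it.\<close>
  have no_pair: False
    if u: "u \<in> V" "card (H `` {u}) < f u" and v: "v \<in> V" "card (H `` {v}) < f v"
      and uv: "u = v \<Longrightarrow> card (H `` {u}) + 2 \<le> f u" for u v
  proof -
    have "H `` A u \<inter> A v = {}"
    proof (rule ccontr)
      assume "H `` A u \<inter> A v \<noteq> {}"
      then obtain x y where xy: "x \<in> A u" "y \<in> A v" "(x, y) \<in> H" by auto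
      have x: "(u, x) \<in> E" "(x, u) \<in> E" "(u, x) \<notin> H" "u \<noteq> x"
        and y: "(v, y) \<in> E" "(y, v) \<in> E" "(v, y) \<notin> H" "v \<noteq> y" and ne: "x \<noteq> y"
        using xy E irr unfolding A_def by (auto simp: sym_def irrefl_def)
      \<comment> \<open>\<open>x\<close> and \<open>y\<close> are saturated while \<open>u\<close>
        and \<open>v\<close> are not. So the two new edges are distinct and no endpoint is
        overloaded by the exchange.\<close>
      have xv: "x \<noteq> v" and yu: "y \<noteq> u" using sat[OF u xy(1)] sat[OF v xy(2)] u v by auto
      let ?D = "del_edge x y H"
      have D: "finite ?D" "sym ?D" "(u, x) \<notin> ?D"
        using finH HE x by (auto simp: finite_del_edge sym_del_edge del_edge_iff)
      let ?I = "ins_edge u x ?D"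
      have I: "finite ?I" "sym ?I" "(v, y) \<notin> ?I"
        using D y xv yu ne by (auto simp: finite_ins_edge sym_ins_edge ins_edge_iff del_edge_iff)
      note dd = degree_del_edge[OF finH HE(2) ne xy(3)] sum_del_edge[OF finH HE(2) ne xy(3)]
      note di = degree_ins_edge[OF D(1,2) x(4) D(3)] sum_ins_edge[OF D(1,2) x(4) D(3)]
      note dj = degree_ins_edge[OF I(1,2) y(4) I(3)] sum_ins_edge[OF I(1,2) y(4) I(3)]
      have "P (ins_edge v y ?I)"
        unfolding P_def
      proof (intro conjI ballI)
        show "ins_edge v y ?I \<subseteq> E" using x y HE by (auto simp: ins_edge_def del_edge_def)
        show "sym (ins_edge v y ?I)" using I by (simp add: sym_ins_edge)
        fix z assume "z \<in> V"
        then show "card (ins_edge v y ?I `` {z}) \<le> f z"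
          unfolding dj di using dd(1)[of z] HE(3)[of z] u(2) v(2) uv x y xv yu ne by (auto split: if_splits)
      qed
      from max[OF this] show False
        using dd(2)[of "\<lambda>_. 1"] di(2)[of "\<lambda>_. 1"] dj(2)[of "\<lambda>_. 1"] by simp
    qed
    \<comment> \<open>Disjointness bounds the two cardinalities together by \<open>card V\<close>,
      whereas \<open>big\<close> at \<open>u\<close> and at \<open>v\<close> makes their sum exceed
      it by at least one.\<close>
    then have "H `` A u \<subseteq> V - A v" using HV by auto
    then have "card (H `` A u) \<le> card (V - A v)" using V by (intro card_mono) auto
    also have "\<dots> = card V - card (A v)" using finite_subset[OF AV V] AV by (intro card_Diff_subset) auto
    finally have "card (H `` A u) + card (A v) \<le> card V" using card_mono[OF V AV[of v]] by linarith
    then show False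
      using cardA[OF u] cardA[OF v] cardW[OF u] big[OF u] big[OF v] by linarith
  qed
  have "card (H `` {v}) = f v" if v: "v \<in> V" for v
  proof (rule ccontr)
    assume "card (H `` {v}) \<noteq> f v"
    then have lt: "card (H `` {v}) < f v" using HE(3)[OF v] by simp
    \<comment> \<open>The total deficiency is even. So if \<open>v\<close> lacks exactly one edge,
      then some other vertex is deficient as well.\<close>
    have "(\<Sum>u\<in>V. f u) = (\<Sum>u\<in>V. card (H `` {u})) + (\<Sum>u\<in>V. f u - card (H `` {u}))"
      using HE(3) by (simp add: sum.distrib[symmetric])
    moreover have "even (\<Sum>u\<in>V. card (H `` {u}))"
      using even_card_symmetric[OF finH HE(2) irr] card_arcs[OF V HV] by simp
    ultimately have "even (\<Sum>u\<in>V. f u - card (H `` {u}))" using ev by simp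
    then have e: "even ((f v - card (H `` {v})) + (\<Sum>u\<in>V - {v}. f u - card (H `` {u})))"
      using sum.remove[OF V v, of "\<lambda>u. f u - card (H `` {u})"] by simp
    show False
    proof (cases "card (H `` {v}) + 2 \<le> f v")
      case True
      then show False using no_pair[OF v lt v lt] by simp
    next
      case False
      then have "f v - card (H `` {v}) = 1" using lt by simp
      then have "(\<Sum>u\<in>V - {v}. f u - card (H `` {u})) \<noteq> 0" using e by (metis even_add odd_one even_zero)
      then obtain u where "u \<in> V - {v}" "f u - card (H `` {u}) \<noteq> 0" by (meson sum.neutral)
      then show False using no_pair[OF v lt, of u] by auto
    qed
  qed
  then show ?thesis using HE by blast
qed

section \<open>Extending a selection of edges at a small vertex set to a regular subgraph\<close>

lemma ex_cover_of_card_le_sum: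
  assumes "finite L" "finite U" "card U \<le> (\<Sum>v\<in>L. c v)"
  shows "\<exists>R. (\<forall>v\<in>L. R v \<subseteq> U \<and> card (R v) \<le> c v) \<and> U \<subseteq> (\<Union>v\<in>L. R v)"
  using assms
proof (induction L arbitrary: U rule: finite_induct)
  case (insert v L)
  \<comment> \<open>Greedy choice: \<open>v\<close> takes as much of \<open>U\<close> as its
    capacity allows; the rest is left to the other vertices.\<close>
  obtain S where S: "S \<subseteq> U" "card S = min (c v) (card U)"
    using obtain_subset_with_card_n[of "min (c v) (card U)" U] by auto
  have "card (U - S) = card U - card S"
    using S insert.prems(1) finite_subset by (intro card_Diff_subset) auto
  then have "card (U - S) \<le> (\<Sum>v\<in>L. c v)"
    using insert.prems insert.hyps S by auto
  then obtain R where R: "\<forall>v\<in>L. R v \<subseteq> U - S \<and> card (R v) \<le> c v" "U - S \<subseteq> (\<Union>v\<in>L. R v)"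
    using insert.IH[of "U - S"] insert.prems by blast
  have "w \<in> L \<Longrightarrow> w \<noteq> v" for w using insert.hyps by auto
  then show ?case
    using R S by (intro exI[of _ "R(v := S)"]) (auto 0 3)
qed auto

text \<open>The edges inside \<open>L\<close> and the selected edges \<open>P\<close> give every
  vertex of \<open>L\<close> degree \<open>k\<close>. What remains is a factor of the graph on
  \<open>V - L\<close> in which \<open>u\<close> has degree \<open>k\<close> minus the number of its
  selections. At most \<open>k * card L\<close> selections are made, so the exchange lemma applies
  with \<open>t = card L\<close>.\<close>

lemma regular_subgraph_of_selection:
  fixes E :: "('a \<times> 'a) set" and \<phi> :: "'a \<Rightarrow> nat"
  assumes V: "finite V" and E: "E \<subseteq> V \<times> V" "sym E" "irrefl E" and L: "L \<subseteq> V"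
    and k: "0 < k" "even (k * card V)"
    and P: "\<And>v. v \<in> L \<Longrightarrow> P v \<subseteq> E `` {v} - L"
      "\<And>v. v \<in> L \<Longrightarrow> card (P v) + card (E `` {v} \<inter> L) = k"
    and cap: "\<And>u. u \<in> V - L \<Longrightarrow> card {v \<in> L. u \<in> P v} \<le> k"
    and deg: "\<And>u. u \<in> V - L \<Longrightarrow> card {w \<in> V - L. \<phi> w \<le> \<phi> u} + k + card L \<le> card (E `` {u} - L) \<or>
      card (V - L) + card L + 2 * k \<le> 2 * card (E `` {u} - L) + 1"
  shows "\<exists>H\<subseteq>E. sym H \<and> (\<forall>v\<in>V. card (H `` {v}) = k)"
proof -
  define E' where "E' = E \<inter> (V - L) \<times> (V - L)"
  define Q where "Q u = {v \<in> L. u \<in> P v}" for u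
  define f where "f u = k - card (Q u)" for u
  have finL: "finite L" using L V finite_subset by auto
  have finE: "finite E" using V E by (meson finite_SigmaI finite_subset)
  have finEv: "finite (E `` {v})" for v using finE by (rule finite_Image)
  have finP: "finite (P v)" if "v \<in> L" for v using P(1)[OF that] finEv by (meson finite_Diff finite_subset)
  have capQ: "card (Q u) \<le> k" if "u \<in> V - L" for u using cap[OF that] by (simp add: Q_def)
  have im: "E' `` {u} = E `` {u} - L" if "u \<in> V - L" for u using that E by (auto simp: E'_def)
  have sumQ: "(\<Sum>u\<in>V - L. card (Q u)) = (\<Sum>v\<in>L. card (P v))"
  proof -
    have "(\<Sum>u\<in>V - L. card (Q u)) = (\<Sum>u\<in>V - L. \<Sum>v\<in>L. if u \<in> P v then 1 else 0)"
      unfolding Q_def using finL by (simp add: sum.If_cases Int_def)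
    also have "\<dots> = (\<Sum>v\<in>L. \<Sum>u\<in>V - L. if u \<in> P v then 1 else 0)" by (rule sum.swap)
    also have "\<dots> = (\<Sum>v\<in>L. card (P v))"
    proof (rule sum.cong[OF refl])
      fix v assume "v \<in> L"
      then have "(V - L) \<inter> {u. u \<in> P v} = P v" using P(1)[of v] E by auto
      then show "(\<Sum>u\<in>V - L. if u \<in> P v then 1 else 0) = card (P v)"
        using V by (simp add: sum.If_cases)
    qed
    finally show ?thesis .
  qed
  have sumP: "(\<Sum>v\<in>L. card (P v)) + (\<Sum>v\<in>L. card (E `` {v} \<inter> L)) = k * card L"
    using P(2) by (simp add: sum.distrib[symmetric])
  have evL: "even (\<Sum>v\<in>L. card (E `` {v} \<inter> L))"
  proof -
    have "(E \<inter> L \<times> L) `` {v} = E `` {v} \<inter> L" if "v \<in> L" for v using that by auto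
    then have "(\<Sum>v\<in>L. card (E `` {v} \<inter> L)) = card (E \<inter> L \<times> L)"
      using card_arcs[OF finL, of "E \<inter> L \<times> L"] by simp
    moreover have "even (card (E \<inter> L \<times> L))"
      using finE E by (intro even_card_symmetric) (auto simp: sym_def irrefl_def)
    ultimately show ?thesis by simp
  qed
  have sumf: "(\<Sum>u\<in>V - L. f u) + (\<Sum>u\<in>V - L. card (Q u)) = k * card (V - L)"
    using capQ by (simp add: f_def sum.distrib[symmetric])
  have cV: "card (V - L) + card L = card V"
    using card_mono[OF V L] card_Diff_subset[OF finL L] by simp
  have "\<exists>H\<subseteq>E'. sym H \<and> (\<forall>v\<in>V - L. card (H `` {v}) = f v)"
  proof (rule f_factor_of_large_degrees[where k = k and t = "card L" and \<phi> = \<phi>])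
    show "(\<Sum>v\<in>V - L. k - f v) \<le> k * card L"
      using sumQ sumP capQ by (simp add: f_def)
    \<comment> \<open>Parity: the prescribed degrees sum to \<open>k * card (V - L)\<close> minus
      the number of selections, and the latter is \<open>k * card L\<close> minus the even sum of
      the degrees inside \<open>L\<close>.\<close>
    have "k * card (V - L) + k * card L = k * card V" using cV by (simp add: algebra_simps flip: distrib_left)
    then have "even (k * card (V - L) + k * card L)" using k(2) by simp
    then show "even (\<Sum>v\<in>V - L. f v)"
      using sumf sumQ sumP evL by (metis even_add)
  qed (use V E k(1) deg im in \<open>auto simp: E'_def f_def sym_def irrefl_def\<close>)
  then obtain H where H: "H \<subseteq> E'" "sym H" "\<And>v. v \<in> V - L \<Longrightarrow> card (H `` {v}) = f v" by blast
  define F where "F = H \<union> (E \<inter> L \<times> L) \<union> (SIGMA v:L. P v) \<union> (SIGMA v:L. P v)\<inverse>"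
  have PE: "(v, u) \<in> E" "(u, v) \<in> E" "u \<in> V - L" if "v \<in> L" "u \<in> P v" for u v
    using P(1)[OF that(1)] that E by (auto simp: sym_def)
  have "F \<subseteq> E" using H(1) PE by (auto simp: F_def E'_def)
  moreover have "sym F" using H(2) E(2) unfolding F_def sym_def by auto
  moreover have "card (F `` {v}) = k" if v: "v \<in> V" for v
  proof (cases "v \<in> L")
    case True
    then have "F `` {v} = P v \<union> (E `` {v} \<inter> L)"
      using H(1) PE by (auto simp: F_def E'_def)
    moreover have "P v \<inter> (E `` {v} \<inter> L) = {}" using P(1)[OF True] by auto
    ultimately show ?thesis
      using P(2)[OF True] finP[OF True] finEv by (simp add: card_Un_disjoint)
  next
    case False
    then have "F `` {v} = H `` {v} \<union> Q v" by (auto simp: F_def Q_def)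
    moreover have "H `` {v} \<inter> Q v = {}" using H(1) by (auto simp: E'_def Q_def)
    moreover have "finite (H `` {v})"
      using H(1) finEv by (rule_tac finite_subset[of _ "E `` {v}"]) (auto simp: E'_def)
    ultimately have "card (F `` {v}) = f v + card (Q v)"
      using H(3)[of v] False v finL by (simp add: card_Un_disjoint Q_def)
    then show ?thesis using capQ[of v] False v by (simp add: f_def)
  qed
  ultimately show ?thesis by blast
qed

text \<open>A vertex can be selected more than \<open>k\<close> times only if
  \<open>card L = k + 1\<close> and it is adjacent to all of \<open>L\<close>. A vertex
  \<open>v\<close> of \<open>L\<close> may refuse as many neighbours as its degree exceeds
  \<open>k\<close>, and \<open>few\<close> guarantees that every common neighbour can be refused by
  someone.\<close>

lemma regular_subgraph_of_few_low_degrees: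
  fixes E :: "('a \<times> 'a) set" and \<phi> :: "'a \<Rightarrow> nat"
  assumes V: "finite V" and E: "E \<subseteq> V \<times> V" "sym E" "irrefl E" and L: "L \<subseteq> V"
    and k: "0 < k" "even (k * card V)"
    and min: "\<And>v. v \<in> L \<Longrightarrow> k \<le> card (E `` {v})"
    and few: "card L \<le> k \<or> card L = k + 1 \<and>
      card {u \<in> V - L. \<forall>v\<in>L. (v, u) \<in> E} \<le> (\<Sum>v\<in>L. card (E `` {v}) - k)"
    and deg: "\<And>u. u \<in> V - L \<Longrightarrow> card {w \<in> V - L. \<phi> w \<le> \<phi> u} + k + card L \<le> card (E `` {u} - L) \<or>
      card (V - L) + card L + 2 * k \<le> 2 * card (E `` {u} - L) + 1"
  shows "\<exists>H\<subseteq>E. sym H \<and> (\<forall>v\<in>V. card (H `` {v}) = k)"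
proof -
  have finL: "finite L" using L V finite_subset by auto
  have finEv: "finite (E `` {v})" for v using V E by (meson finite_SigmaI finite_subset finite_Image)
  have inner: "card (E `` {v} \<inter> L) \<le> k" if "v \<in> L" for v
  proof -
    have "card (E `` {v} \<inter> L) \<le> card (L - {v})"
      using E(3) finL by (intro card_mono) (auto simp: irrefl_def)
    then show ?thesis using few finL that by auto
  qed
  have split: "card (E `` {v} - L) + card (E `` {v} \<inter> L) = card (E `` {v})" for v
    using finEv[of v] by (subst card_Un_disjoint[symmetric]) (auto intro: arg_cong[of _ _ card])
  define U where "U = {u \<in> V - L. \<forall>v\<in>L. (v, u) \<in> E}"
  \<comment> \<open>\<open>R v\<close> is the set of common neighbours refused by \<open>v\<close>.
    Nothing has to be refused when \<open>card L \<le> k\<close>.\<close>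
  have "\<exists>R. (\<forall>v\<in>L. R v \<subseteq> U \<and> card (R v) \<le> card (E `` {v}) - k) \<and> (card L \<le> k \<or> U \<subseteq> (\<Union>v\<in>L. R v))"
  proof (cases "card L \<le> k")
    case True
    then show ?thesis by (intro exI[of _ "\<lambda>_. {}"]) auto
  next
    case False
    then have "card U \<le> (\<Sum>v\<in>L. card (E `` {v}) - k)" using few by (auto simp: U_def)
    from ex_cover_of_card_le_sum[OF finL _ this] show ?thesis using V by (auto simp: U_def)
  qed
  then obtain R where R: "\<And>v. v \<in> L \<Longrightarrow> R v \<subseteq> U" "\<And>v. v \<in> L \<Longrightarrow> card (R v) \<le> card (E `` {v}) - k"
    "card L \<le> k \<or> U \<subseteq> (\<Union>v\<in>L. R v)" by blast
  have "\<exists>P. P \<subseteq> E `` {v} - L - R v \<and> card P = k - card (E `` {v} \<inter> L)" if v: "v \<in> L" for v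
  proof -
    have sub: "R v \<subseteq> E `` {v} - L" using R(1)[OF v] v by (auto simp: U_def)
    then have "finite (R v)" using finEv by (meson finite_Diff finite_subset)
    then have "card (E `` {v} - L - R v) = card (E `` {v} - L) - card (R v)"
      using sub by (intro card_Diff_subset)
    \<comment> \<open>Refusing at most the excess over \<open>k\<close> leaves at least
      \<open>k\<close> neighbours, counting those inside \<open>L\<close>.\<close>
    then have "k - card (E `` {v} \<inter> L) \<le> card (E `` {v} - L - R v)"
      using split[of v] R(2)[OF v] min[OF v] inner[OF v] by linarith
    then show ?thesis using obtain_subset_with_card_n by metis
  qed
  then obtain P where P: "\<And>v. v \<in> L \<Longrightarrow> P v \<subseteq> E `` {v} - L - R v"
    "\<And>v. v \<in> L \<Longrightarrow> card (P v) = k - card (E `` {v} \<inter> L)" by metis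
  show ?thesis
  proof (rule regular_subgraph_of_selection[OF V E L k, where P = P and \<phi> = \<phi>])
    fix u assume u: "u \<in> V - L"
    show "card {v \<in> L. u \<in> P v} \<le> k"
    proof (cases "card L \<le> k")
      case True
      have "card {v \<in> L. u \<in> P v} \<le> card L" using finL by (intro card_mono) auto
      then show ?thesis using True by simp
    next
      case False
      have "\<exists>v\<in>L. u \<notin> P v"
      proof (cases "u \<in> U")
        case True
        then show ?thesis using R(3) False P(1) by blast
      next
        case False
        then show ?thesis using u P(1) by (fastforce simp: U_def)
      qed
      then have "{v \<in> L. u \<in> P v} \<subset> L" by auto
      then have "card {v \<in> L. u \<in> P v} < card L" by (rule psubset_card_mono[OF finL])
      then show ?thesis using few False by simp
    qed
  qed (use P inner deg in auto)
qed

subsection \<open>The spectral radius as a Rayleigh quotient\<close>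

text \<open>Compactness of the unit sphere, inside the function space with the product topology.
  Coordinates outside \<open>V\<close> are pinned to 0, so the cube \<open>B\<close> is compact by
  Tychonoff even over an infinite type. Homogeneity extends the bound from the sphere to all
  \<open>z\<close>.\<close>

lemma quadratic_form_attains_max:
  fixes E :: "('a \<times> 'a) set"
  assumes V: "finite V" "V \<noteq> {}" and E: "E \<subseteq> V \<times> V"
  obtains x :: "'a \<Rightarrow> real" and m
  where "(\<Sum>v\<in>V. (x v)\<^sup>2) = 1" "(\<Sum>(u, v)\<in>E. x u * x v) = m"
    "\<forall>z. (\<Sum>(u, v)\<in>E. z u * z v) \<le> m * (\<Sum>v\<in>V. (z v)\<^sup>2)"
proof -
  define B where "B = PiE UNIV (\<lambda>v. if v \<in> V then {-1..1::real} else {0})"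
  define K where "K = B \<inter> {x. (\<Sum>v\<in>V. (x v)\<^sup>2) = 1}"
  have "compactin (product_topology (\<lambda>_. euclidean) UNIV) B"
    unfolding B_def compactin_PiE by (auto simp: compactin_euclidean_iff)
  then have "compact B"
    by (simp add: euclidean_product_topology)
  moreover have "closed {x::'a \<Rightarrow> real. (\<Sum>v\<in>V. (x v)\<^sup>2) = 1}"
    by (intro closed_Collect_eq continuous_intros continuous_on_product_coordinates)
  ultimately have K: "compact K"
    unfolding K_def by (rule compact_Int_closed)
  have le1: "(\<bar>y v\<bar> \<le> 1)" if "(\<Sum>v\<in>V. (y v)\<^sup>2) = 1" "v \<in> V" for y :: "'a \<Rightarrow> real" and v
  proof -
    have "(y v)\<^sup>2 \<le> (\<Sum>v\<in>V. (y v)\<^sup>2)"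
      using that V by (intro member_le_sum) auto
    then have "(y v)\<^sup>2 \<le> 1"
      using that(1) by linarith
    then show ?thesis
      by (simp add: abs_square_le_1)
  qed
  have inK: "(\<lambda>v. if v \<in> V then y v else 0) \<in> K" if "(\<Sum>v\<in>V. (y v)\<^sup>2) = 1" for y :: "'a \<Rightarrow> real"
    using le1[OF that] that unfolding K_def B_def by (auto simp: abs_le_iff minus_le_iff)
  obtain v0 where v0: "v0 \<in> V" using V by auto
  have "(\<Sum>v\<in>V. ((\<lambda>v. if v = v0 then 1::real else 0) v)\<^sup>2) = 1"
    using v0 V by (subst sum.cong[OF refl, of _ _ "\<lambda>v. if v = v0 then 1 else 0"]) auto
  from inK[OF this] have ne: "K \<noteq> {}" by blast
  have "continuous_on K (\<lambda>x. \<Sum>e\<in>E. x (fst e) * x (snd e))"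
    by (intro continuous_intros continuous_on_product_coordinates[THEN continuous_on_subset]) auto
  from continuous_attains_sup[OF K ne this]
  obtain x where x: "x \<in> K"
    "\<And>y. y \<in> K \<Longrightarrow> (\<Sum>e\<in>E. y (fst e) * y (snd e)) \<le> (\<Sum>e\<in>E. x (fst e) * x (snd e))" by blast
  define m where "m = (\<Sum>e\<in>E. x (fst e) * x (snd e))"
  have "(\<Sum>(u, v)\<in>E. z u * z v) \<le> m * (\<Sum>v\<in>V. (z v)\<^sup>2)" for z
  proof (cases "(\<Sum>v\<in>V. (z v)\<^sup>2) = 0")
    case True
    then have "z v = 0" if "v \<in> V" for v
      using that V by (simp add: sum_nonneg_eq_0_iff)
    then have "(\<Sum>(u, v)\<in>E. z u * z v) = 0"
      using E by (intro sum.neutral) auto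
    then show ?thesis using True by simp
  next
    case False
    define N where "N = (\<Sum>v\<in>V. (z v)\<^sup>2)"
    have N: "N > 0"
      using False sum_nonneg[of V "\<lambda>v. (z v)\<^sup>2"] unfolding N_def by (simp add: less_eq_real_def)
    have "(\<Sum>v\<in>V. (z v / sqrt N)\<^sup>2) = 1"
      using N unfolding N_def by (simp add: power_divide sum_divide_distrib[symmetric])
    from x(2)[OF inK[OF this]]
    have "(\<Sum>e\<in>E. (if fst e \<in> V then z (fst e) / sqrt N else 0) * (if snd e \<in> V then z (snd e) / sqrt N else 0)) \<le> m"
      unfolding m_def .
    also have "(\<Sum>e\<in>E. (if fst e \<in> V then z (fst e) / sqrt N else 0) * (if snd e \<in> V then z (snd e) / sqrt N else 0))
       = (\<Sum>e\<in>E. z (fst e) * z (snd e) / N)"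
    proof (intro sum.cong refl)
      fix e assume "e \<in> E"
      then have "fst e \<in> V" "snd e \<in> V" using E by auto
      then show "(if fst e \<in> V then z (fst e) / sqrt N else 0) * (if snd e \<in> V then z (snd e) / sqrt N else 0)
        = z (fst e) * z (snd e) / N" using N by simp
    qed
    also have "\<dots> = (\<Sum>(u, v)\<in>E. z u * z v) / N"
      by (simp add: sum_divide_distrib[symmetric] case_prod_unfold)
    finally show ?thesis
      using N unfolding N_def[symmetric] by (simp add: divide_le_eq)
  qed
  moreover have "(\<Sum>v\<in>V. (x v)\<^sup>2) = 1" using x(1) unfolding K_def by simp
  moreover have "(\<Sum>(u, v)\<in>E. x u * x v) = m" by (simp add: m_def case_prod_unfold)
  ultimately show thesis using that by blast
qed

text \<open>The first-order condition at a maximiser of the Rayleigh quotient is the eigenvalue equation.\<close>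

lemma quadratic_form_max_eigenvector:
  fixes x :: "'a \<Rightarrow> real"
  assumes V: "finite V" and E: "E \<subseteq> V \<times> V" "sym E" "irrefl E"
    and x: "(\<Sum>(u, v)\<in>E. x u * x v) = m * (\<Sum>v\<in>V. (x v)\<^sup>2)"
    and le: "\<And>z. (\<Sum>(u, v)\<in>E. z u * z v) \<le> m * (\<Sum>v\<in>V. (z v)\<^sup>2)"
    and w: "w \<in> V"
  shows "(\<Sum>v\<in>E `` {w}. x v) = m * x w"
proof -
  define b where "b = (\<Sum>v\<in>E `` {w}. x v)"
  define d where "d = (\<lambda>v. if v = w then 1::real else 0)"
  have d_mult: "d u * y = (if u = w then y else 0)" "y * d u = (if u = w then y else 0)" for u y
    by (simp_all add: d_def)
  have fin: "finite (E `` {u})" for u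
    using V E by (meson finite_Image finite_SigmaI finite_subset)
  have finE: "finite E" using V E by (meson finite_SigmaI finite_subset)
  have 1: "(\<Sum>(u, v)\<in>E. d u * x v) = b"
  proof -
    have "(\<Sum>(u, v)\<in>E. d u * x v) = (\<Sum>u\<in>V. d u * (\<Sum>v\<in>E `` {u}. x v))"
      using sum_arcs[OF V E(1), of "\<lambda>u v. d u * x v"] by (simp add: sum_distrib_left)
    also have "\<dots> = b" using V w by (simp add: d_mult b_def)
    finally show ?thesis .
  qed
  have 2: "(\<Sum>(u, v)\<in>E. x u * d v) = b"
  proof -
    have "(\<Sum>(u, v)\<in>E. x u * d v) = (\<Sum>(u, v)\<in>E\<inverse>. d u * x v)"
      by (rule sum.reindex_bij_witness[of _ prod.swap prod.swap]) auto
    then show ?thesis using 1 E(2) by (simp add: sym_conv_converse_eq)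
  qed
  have 3: "(\<Sum>(u, v)\<in>E. d u * d v) = 0"
    using E(3) by (intro sum.neutral) (auto simp: d_def irrefl_def)
  have dd: "(\<Sum>v\<in>V. x v * d v) = x w" "(\<Sum>v\<in>V. d v * d v) = 1"
    using V w by (simp_all add: d_mult) (simp add: d_def)
  \<comment> \<open>The maximum property at \<open>x\<close> perturbed by \<open>t\<close> times the
    indicator \<open>d\<close> of \<open>w\<close>. The terms linear in \<open>t\<close> must
    cancel.\<close>
  have ineq: "2 * t * (b - m * x w) \<le> m * t\<^sup>2" for t
  proof -
    have "(\<Sum>(u, v)\<in>E. (x u + t * d u) * (x v + t * d v)) =
      (\<Sum>(u, v)\<in>E. x u * x v) + t * (\<Sum>(u, v)\<in>E. d u * x v) + t * (\<Sum>(u, v)\<in>E. x u * d v)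
        + t\<^sup>2 * (\<Sum>(u, v)\<in>E. d u * d v)"
    proof -
      have "(x u + t * d u) * (x v + t * d v) = x u * x v + t * (d u * x v) + t * (x u * d v) + t\<^sup>2 * (d u * d v)" for u v
        by (simp add: algebra_simps power2_eq_square)
      then show ?thesis
        unfolding sum_distrib_left by (simp only: sum.distrib case_prod_unfold)
    qed
    also have "\<dots> = m * (\<Sum>v\<in>V. (x v)\<^sup>2) + 2 * t * b" using 1 2 3 x by simp
    finally have "m * (\<Sum>v\<in>V. (x v)\<^sup>2) + 2 * t * b \<le> m * (\<Sum>v\<in>V. (x v + t * d v)\<^sup>2)"
      using le[of "\<lambda>v. x v + t * d v"] by simp
    also have "(\<Sum>v\<in>V. (x v + t * d v)\<^sup>2) = (\<Sum>v\<in>V. (x v)\<^sup>2) + 2 * t * (\<Sum>v\<in>V. x v * d v) + t\<^sup>2 * (\<Sum>v\<in>V. d v * d v)"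
    proof -
      have "(x v + t * d v)\<^sup>2 = (x v)\<^sup>2 + 2 * t * (x v * d v) + t\<^sup>2 * (d v * d v)" for v
        by (simp add: algebra_simps power2_eq_square)
      then show ?thesis
        unfolding sum_distrib_left by (simp only: sum.distrib)
    qed
    finally show ?thesis unfolding dd by (simp add: algebra_simps)
  qed
  have "b - m * x w = 0"
  proof (rule ccontr)
    let ?c = "b - m * x w"
    assume c: "?c \<noteq> 0"
    \<comment> \<open>\<open>M\<close> is positive and exceeds \<open>\<bar>m\<bar>\<close>, so at
      \<open>t = ?c / M\<close> the linear term of \<open>ineq\<close> is twice the bound available
      for the quadratic one.\<close>
    define M where "M = \<bar>m\<bar> + 1"
    have M: "M > 0" unfolding M_def by simp
    have "2 * (?c / M) * ?c \<le> m * (?c / M)\<^sup>2" by (rule ineq)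
    also have "\<dots> \<le> M * (?c / M)\<^sup>2" unfolding M_def by (intro mult_right_mono) auto
    also have "\<dots> = ?c\<^sup>2 / M" using M by (simp add: power2_eq_square)
    also have "2 * (?c / M) * ?c = 2 * (?c\<^sup>2 / M)" by (simp add: power2_eq_square)
    finally have "?c\<^sup>2 / M \<le> 0" by linarith
    moreover have "?c\<^sup>2 / M > 0" using c M by simp
    ultimately show False by simp
  qed
  then show ?thesis unfolding b_def by simp
qed

section \<open>Spectral radius and Perron vector of a graph\<close>

lemma pair_graph_arcs:
  assumes "pair_graph G"
  shows "finite (pverts G)" "parcs G \<subseteq> pverts G \<times> pverts G" "sym (parcs G)" "irrefl (parcs G)"
proof -
  interpret pair_graph G by fact
  show "finite (pverts G)" by (rule pair_finite_verts)
  show "parcs G \<subseteq> pverts G \<times> pverts G" using wellformed by fastforce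
  show "sym (parcs G)" using sym_arcs unfolding symmetric_def by (simp add: arcs_ends_conv)
  show "irrefl (parcs G)" using no_loops' unfolding irrefl_def by auto
qed

lemma out_degree_eq_card_Image: "out_degree G v = card (parcs G `` {v})" for G :: "'a pair_pre_digraph"
proof -
  have "parcs G `` {v} = snd ` out_arcs G v" by (force simp: out_arcs_def)
  moreover have "inj_on snd (out_arcs G v)" by (auto simp: out_arcs_def inj_on_def)
  ultimately show ?thesis by (simp add: out_degree_def card_image)
qed

text \<open>The vector \<open>x\<close> puts \<open>m\<close> into the spectrum. Evaluating the
  quadratic form at an eigenvector of any eigenvalue \<open>l\<close> gives
  \<open>l \<le> m\<close>.\<close>

lemma graph_spectral_radius_eqI:
  assumes G: "pair_graph G"
    and x: "\<exists>v\<in>pverts G. x v \<noteq> 0" "\<And>u. u \<in> pverts G \<Longrightarrow> (\<Sum>v\<in>parcs G `` {u}. x v) = m * x u"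
    and le: "\<And>z. (\<Sum>(u, v)\<in>parcs G. z u * z v) \<le> m * (\<Sum>v\<in>pverts G. (z v)\<^sup>2)"
  shows "graph_spectral_radius G = m"
proof -
  note G' = pair_graph_arcs[OF G]
  define vs where "vs = (SOME vs. distinct vs \<and> set vs = pverts G)"
  have "\<exists>vs. distinct vs \<and> set vs = pverts G"
    using finite_distinct_list[OF G'(1)] by blast
  from someI_ex[OF this] have vs: "distinct vs" "set vs = pverts G"
    unfolding vs_def by simp_all
  have nb: "{v \<in> pverts G. (u, v) \<in> parcs G} = parcs G `` {u}" for u
    using G'(2) by auto
  note ev = eigenvalue_adjacency_mat_iff[OF vs, unfolded nb]
  have A: "adjacency_mat G vs \<in> carrier_mat (length vs) (length vs)" by (simp add: adjacency_mat_def)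
  have "Max (spectrum (adjacency_mat G vs)) = m"
  proof (rule Max_eqI)
    show "finite (spectrum (adjacency_mat G vs))" using card_finite_spectrum[OF A] by blast
    show "m \<in> spectrum (adjacency_mat G vs)" using x by (auto simp: spectrum_def ev)
    fix l assume "l \<in> spectrum (adjacency_mat G vs)"
    then obtain f where f: "\<exists>v\<in>pverts G. f v \<noteq> 0"
      "\<And>u. u \<in> pverts G \<Longrightarrow> (\<Sum>v\<in>parcs G `` {u}. f v) = l * f u"
      by (auto simp: spectrum_def ev)
    have "(\<Sum>(u, v)\<in>parcs G. f u * f v) = (\<Sum>u\<in>pverts G. f u * (\<Sum>v\<in>parcs G `` {u}. f v))"
      using sum_arcs[OF G'(1,2), of "\<lambda>u v. f u * f v"] by (simp add: sum_distrib_left)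
    also have "\<dots> = l * (\<Sum>u\<in>pverts G. (f u)\<^sup>2)"
      by (simp add: f(2) sum_distrib_left power2_eq_square algebra_simps)
    finally have "l * (\<Sum>u\<in>pverts G. (f u)\<^sup>2) \<le> m * (\<Sum>u\<in>pverts G. (f u)\<^sup>2)"
      using le[of f] by simp
    moreover obtain v where "v \<in> pverts G" "f v \<noteq> 0" using f by blast
    then have "(\<Sum>u\<in>pverts G. (f u)\<^sup>2) > 0" using G'(1) by (intro sum_pos2) auto
    ultimately show "l \<le> m" by simp
  qed
  then show ?thesis by (simp add: graph_spectral_radius_def vs_def)
qed

text \<open>The maximum of the Rayleigh quotient is an eigenvalue by its first-order condition, and
  hence the spectral radius. Absolute values turn a maximiser into a nonnegative one, and division
  by the largest entry normalises it.\<close>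

lemma
  assumes G: "pair_graph G" and ne: "pverts G \<noteq> {}"
  shows rayleigh: "(\<Sum>(u, v)\<in>parcs G. z u * z v) \<le> graph_spectral_radius G * (\<Sum>v\<in>pverts G. (z v)\<^sup>2)"
    and perron_vector: "\<exists>x. (\<forall>v\<in>pverts G. 0 \<le> x v \<and> x v \<le> 1) \<and> (\<exists>v\<in>pverts G. x v = 1) \<and>
      (\<forall>u\<in>pverts G. (\<Sum>v\<in>parcs G `` {u}. x v) = graph_spectral_radius G * x u)"
proof -
  note G' = pair_graph_arcs[OF G]
  obtain x and m :: real where x: "(\<Sum>v\<in>pverts G. (x v)\<^sup>2) = 1" "(\<Sum>(u, v)\<in>parcs G. x u * x v) = m"
    and le: "\<And>z. (\<Sum>(u, v)\<in>parcs G. z u * z v) \<le> m * (\<Sum>v\<in>pverts G. (z v)\<^sup>2)"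
    by (rule quadratic_form_attains_max[OF G'(1) ne G'(2)]) blast
  define y where "y = (\<lambda>v. \<bar>x v\<bar>)"
  have y1: "(\<Sum>v\<in>pverts G. (y v)\<^sup>2) = 1" using x by (simp add: y_def)
  \<comment> \<open>Passing to absolute values cannot decrease any summand, so \<open>y\<close> is
    again a maximiser.\<close>
  have "m \<le> (\<Sum>(u, v)\<in>parcs G. y u * y v)"
    unfolding x(2)[symmetric] y_def by (intro sum_mono) (auto simp: abs_mult[symmetric])
  then have y2: "(\<Sum>(u, v)\<in>parcs G. y u * y v) = m * (\<Sum>v\<in>pverts G. (y v)\<^sup>2)"
    using le[of y] y1 by simp
  note ye = quadratic_form_max_eigenvector[OF G' y2 le]
  define M where "M = Max (y ` pverts G)"
  obtain v0 where v0: "v0 \<in> pverts G" "y v0 \<noteq> 0"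
    using y1 sum.neutral[of "pverts G" "\<lambda>v. (y v)\<^sup>2"] by fastforce
  have yM: "y v \<le> M" if "v \<in> pverts G" for v using that G'(1) by (simp add: M_def)
  have "y v0 > 0" using v0 by (simp add: y_def)
  then have M: "M > 0" using yM[OF v0(1)] by linarith
  have "M \<in> y ` pverts G" unfolding M_def using G'(1) ne by (intro Max_in) auto
  then obtain v1 where v1: "v1 \<in> pverts G" "y v1 = M" by auto
  have rad: "graph_spectral_radius G = m"
    by (rule graph_spectral_radius_eqI[OF G _ ye le]) (use v0 in auto)
  show "(\<Sum>(u, v)\<in>parcs G. z u * z v) \<le> graph_spectral_radius G * (\<Sum>v\<in>pverts G. (z v)\<^sup>2)"
    unfolding rad by (rule le)
  show "\<exists>x. (\<forall>v\<in>pverts G. 0 \<le> x v \<and> x v \<le> 1) \<and> (\<exists>v\<in>pverts G. x v = 1) \<and>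
      (\<forall>u\<in>pverts G. (\<Sum>v\<in>parcs G `` {u}. x v) = graph_spectral_radius G * x u)"
    by (rule exI[of _ "\<lambda>v. y v / M"])
      (use M yM v1 ye in \<open>auto simp: rad sum_divide_distrib[symmetric] y_def divide_simps\<close>)
qed

subsection \<open>The extremal graph on an arbitrary vertex set\<close>

text \<open>
  In the notation of the extremal graph, \<open>C\<close> is the union of the two cliques, \<open>S\<close> is \<open>K\<^sub>k\<close>, \<open>L\<close> is the
  independent set, and \<open>a \<in> L\<close> is the vertex connected to the \<open>k - 1\<close> further vertices \<open>R\<close>.
\<close>

definition extremal_arcs :: "'a set \<Rightarrow> 'a set \<Rightarrow> 'a set \<Rightarrow> 'a set \<Rightarrow> 'a \<Rightarrow> ('a \<times> 'a) set" where
  "extremal_arcs C S R L a = {(u, v). u \<in> C \<and> v \<in> C \<and> u \<noteq> v} \<union> L \<times> S \<union> S \<times> L \<union> {a} \<times> R \<union> R \<times> {a}"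

lemma extremal_arcs_iff:
  "(u, v) \<in> extremal_arcs C S R L a \<longleftrightarrow>
    u \<in> C \<and> v \<in> C \<and> u \<noteq> v \<or> u \<in> L \<and> v \<in> S \<or> u \<in> S \<and> v \<in> L \<or> u = a \<and> v \<in> R \<or> u \<in> R \<and> v = a"
  by (auto simp: extremal_arcs_def)

text \<open>Adjacency depends only on these memberships and on equality, so a bijection respecting
  the blocks preserves it.\<close>

lemma extremal_arcs_cong:
  assumes "u' \<in> C' \<longleftrightarrow> u \<in> C" "u' \<in> S' \<longleftrightarrow> u \<in> S" "u' \<in> R' \<longleftrightarrow> u \<in> R" "u' \<in> L' \<longleftrightarrow> u \<in> L" "u' = a' \<longleftrightarrow> u = a"
    and "v' \<in> C' \<longleftrightarrow> v \<in> C" "v' \<in> S' \<longleftrightarrow> v \<in> S" "v' \<in> R' \<longleftrightarrow> v \<in> R" "v' \<in> L' \<longleftrightarrow> v \<in> L" "v' = a' \<longleftrightarrow> v = a"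
    and "u' = v' \<longleftrightarrow> u = v"
  shows "(u', v') \<in> extremal_arcs C' S' R' L' a' \<longleftrightarrow> (u, v) \<in> extremal_arcs C S R L a"
  by (simp add: extremal_arcs_iff assms)

lemma extremal_arcs_Int_clique:
  fixes a :: 'a
  assumes "C \<inter> L = {}" "a \<in> L"
  shows "extremal_arcs C S R L a \<inter> C \<times> C = C \<times> C - Id_on C"
proof -
  have CL: "x \<notin> L" if "x \<in> C" for x using assms that by blast
  have iff: "(u, v) \<in> extremal_arcs C S R L a \<longleftrightarrow> u \<noteq> v" if "u \<in> C" "v \<in> C" for u v
    using CL[OF that(1)] CL[OF that(2)] that assms(2) by (auto simp: extremal_arcs_iff)
  show ?thesis
  proof (rule Set.set_eqI)
    fix e :: "'a \<times> 'a"
    obtain u v where e: "e = (u, v)" by fastforce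
    show "e \<in> extremal_arcs C S R L a \<inter> C \<times> C \<longleftrightarrow> e \<in> C \<times> C - Id_on C"
      using iff[of u v] unfolding e by (auto simp: Id_on_iff)
  qed
qed

lemma parcs_extremal_graph:
  "parcs (extremal_graph n k) =
    extremal_arcs ({0..<k} \<union> {2 * k + 1..<n}) {0..<k} {2 * k + 1..<3 * k} {k..<2 * k + 1} k"
proof -
  have "parcs (connect_to a W (graph_join (complete_graph A)
      (graph_union (graph_complement (complete_graph B)) (complete_graph D)))) = extremal_arcs (A \<union> D) A W B a"
    if "A \<inter> D = {}" for a :: nat and W A B D
  proof -
    have AD: "x \<notin> D" if "x \<in> A" for x using \<open>A \<inter> D = {}\<close> that by blast
    show ?thesis
      unfolding extremal_arcs_def connect_to_def graph_join_def graph_union_def graph_complement_def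
        complete_graph_def using AD by auto
  qed
  then show ?thesis unfolding extremal_graph_def by simp
qed

text \<open>The vertices are numbered block by block: \<open>S\<close>, then \<open>a\<close>, the
  rest of \<open>L\<close>, \<open>R\<close>, and finally the rest of the clique. Each block has the
  size of its interval in \<open>extremal_graph\<close>.\<close>

lemma extremal_arcs_bij:
  assumes fin: "finite C" "finite L" and sub: "S \<subseteq> C" "R \<subseteq> C - S" "C \<inter> L = {}" "a \<in> L"
    and card: "card S = k" "card R = k - 1" "card L = k + 1" "card C + card L = n"
    and k: "2 \<le> k" "3 * k \<le> n"
  shows "\<exists>g. bij_betw g (C \<union> L) {0..<n} \<and>
    (\<forall>u\<in>C \<union> L. \<forall>v\<in>C \<union> L. (g u, g v) \<in> parcs (extremal_graph n k) \<longleftrightarrow> (u, v) \<in> extremal_arcs C S R L a)"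
proof -
  have finS: "finite S" "finite R" using fin sub by (auto intro: finite_subset)
  have "card (C - S - R) = card C - card S - card R"
    using sub finS by (simp add: card_Diff_subset)
  then have cD: "card (C - S - R) = n - 3 * k" using card k by simp
  have "\<exists>g. bij_betw g S {0..<k}" using finS card by (intro finite_same_card_bij) auto
  then obtain g1 where g1: "bij_betw g1 S {0..<k}" by blast
  have "\<exists>g. bij_betw g (L - {a}) {k + 1..<2 * k + 1}" using fin sub card by (intro finite_same_card_bij) auto
  then obtain g2 where g2: "bij_betw g2 (L - {a}) {k + 1..<2 * k + 1}" by blast
  have "\<exists>g. bij_betw g R {2 * k + 1..<3 * k}" using finS card k by (intro finite_same_card_bij) auto
  then obtain g3 where g3: "bij_betw g3 R {2 * k + 1..<3 * k}" by blast
  have "\<exists>g. bij_betw g (C - S - R) {3 * k..<n}" using fin cD by (intro finite_same_card_bij) auto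
  then obtain g4 where g4: "bij_betw g4 (C - S - R) {3 * k..<n}" by blast
  define g where "g u = (if u \<in> S then g1 u else if u = a then k else if u \<in> L then g2 u
    else if u \<in> R then g3 u else g4 u)" for u
  have b1: "bij_betw g S {0..<k}" using g1 by (rule bij_betw_cong[THEN iffD1, rotated]) (auto simp: g_def)
  have b0: "bij_betw g {a} {k}" using sub by (auto simp: bij_betw_def g_def)
  have b2: "bij_betw g (L - {a}) {k + 1..<2 * k + 1}"
    using g2 by (rule bij_betw_cong[THEN iffD1, rotated]) (use sub in \<open>auto simp: g_def\<close>)
  have b3: "bij_betw g R {2 * k + 1..<3 * k}"
    using g3 by (rule bij_betw_cong[THEN iffD1, rotated]) (use sub in \<open>auto simp: g_def\<close>)
  have b4: "bij_betw g (C - S - R) {3 * k..<n}"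
    using g4 by (rule bij_betw_cong[THEN iffD1, rotated]) (use sub in \<open>auto simp: g_def\<close>)
  have "bij_betw g (S \<union> {a} \<union> (L - {a}) \<union> R \<union> (C - S - R))
    ({0..<k} \<union> {k} \<union> {k + 1..<2 * k + 1} \<union> {2 * k + 1..<3 * k} \<union> {3 * k..<n})"
    using k by (intro bij_betw_combine b0 b1 b2 b3 b4) auto
  moreover have "S \<union> {a} \<union> (L - {a}) \<union> R \<union> (C - S - R) = C \<union> L" using sub by auto
  moreover have "{0..<k} \<union> {k} \<union> {k + 1..<2 * k + 1} \<union> {2 * k + 1..<3 * k} \<union> {3 * k..<n} = {0..<n}"
    using k by auto
  ultimately have bij: "bij_betw g (C \<union> L) {0..<n}" by simp
  have m1: "g u < k" if "u \<in> S" for u using bij_betwE[OF b1] that by auto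
  have m0: "g a = k" using sub by (auto simp: g_def)
  have m2: "k + 1 \<le> g u \<and> g u < 2 * k + 1" if "u \<in> L" "u \<noteq> a" for u using bij_betwE[OF b2] that by auto
  have m3: "2 * k + 1 \<le> g u \<and> g u < 3 * k" if "u \<in> R" for u using bij_betwE[OF b3] that by auto
  have m4: "3 * k \<le> g u \<and> g u < n" if "u \<in> C" "u \<notin> S" "u \<notin> R" for u using bij_betwE[OF b4] that by auto
  have pos: "(g u \<in> {0..<k} \<longleftrightarrow> u \<in> S) \<and> (g u \<in> {k..<2 * k + 1} \<longleftrightarrow> u \<in> L) \<and> (g u = k \<longleftrightarrow> u = a) \<and>
    (g u \<in> {2 * k + 1..<3 * k} \<longleftrightarrow> u \<in> R) \<and> (g u \<in> {0..<k} \<union> {2 * k + 1..<n} \<longleftrightarrow> u \<in> C)"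
    if u: "u \<in> C \<union> L" for u
  proof -
    have L: "u \<notin> C \<and> u \<notin> S \<and> u \<notin> R" if "u \<in> L" for u using sub that by auto
    consider "u \<in> S" | "u = a" | "u \<in> L" "u \<noteq> a" | "u \<in> R" | "u \<in> C" "u \<notin> S" "u \<notin> R" using u by blast
    then show ?thesis
    proof cases
      case 1
      then have "u \<in> C" "u \<notin> L" "u \<notin> R" "u \<noteq> a" using L sub by auto
      then show ?thesis using 1 m1[OF 1] k by simp
    next
      case 2
      then show ?thesis using L[OF sub(4)] sub(4) m0 k by simp
    next
      case 3
      then show ?thesis using L[OF 3(1)] m2[OF 3] k by simp
    next
      case 4
      then have "u \<in> C" "u \<notin> L" "u \<notin> S" "u \<noteq> a" using L sub by auto
      then show ?thesis using 4 m3[OF 4] k by simp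
    next
      case 5
      then have "u \<notin> L" "u \<noteq> a" using L sub by auto
      then show ?thesis using 5 m4[OF 5] k by simp
    qed
  qed
  have "(g u, g v) \<in> parcs (extremal_graph n k) \<longleftrightarrow> (u, v) \<in> extremal_arcs C S R L a"
    if "u \<in> C \<union> L" "v \<in> C \<union> L" for u v
  proof -
    have "g u = g v \<longleftrightarrow> u = v" using bij that by (auto simp: bij_betw_def dest: inj_onD)
    then show ?thesis
      unfolding parcs_extremal_graph
      using pos[OF that(1)] pos[OF that(2)] by (elim conjE) (rule extremal_arcs_cong)
  qed
  with bij show ?thesis by blast
qed

lemma digraph_iso_extremal_graphI:
  fixes G :: "'a pair_pre_digraph"
  assumes G: "pair_graph G" "pverts G = C \<union> L" "parcs G = extremal_arcs C S R L a"
    and fin: "finite C" "finite L" and sub: "S \<subseteq> C" "R \<subseteq> C - S" "C \<inter> L = {}" "a \<in> L"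
    and card: "card S = k" "card R = k - 1" "card L = k + 1" "card C + card L = n"
    and k: "2 \<le> k" "3 * k \<le> n"
  shows "digraph_iso G (extremal_graph n k)"
proof -
  obtain g where g: "bij_betw g (C \<union> L) {0..<n}"
    "\<And>u v. u \<in> C \<union> L \<Longrightarrow> v \<in> C \<union> L \<Longrightarrow>
      (g u, g v) \<in> parcs (extremal_graph n k) \<longleftrightarrow> (u, v) \<in> extremal_arcs C S R L a"
    using extremal_arcs_bij[OF fin sub card k] by blast
  note W = pair_graph_arcs[OF extremal_graph_wf(1)[OF k]] extremal_graph_wf(2)[OF k]
  have arcs: "map_prod g g ` parcs G = parcs (extremal_graph n k)"
  proof (intro equalityI subsetI)
    fix e assume "e \<in> map_prod g g ` parcs G"
    then obtain u v where e: "e = (g u, g v)" "(u, v) \<in> parcs G" by auto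
    then have "u \<in> C \<union> L" "v \<in> C \<union> L" using G(2) pair_graph_arcs(2)[OF G(1)] by auto
    then show "e \<in> parcs (extremal_graph n k)" using g(2) G(3) e by simp
  next
    fix e assume e: "e \<in> parcs (extremal_graph n k)"
    then have "fst e \<in> g ` (C \<union> L)" "snd e \<in> g ` (C \<union> L)"
      using W(2,5) g(1) by (auto simp: bij_betw_def)
    then obtain u v where uv: "u \<in> C \<union> L" "v \<in> C \<union> L" "e = (g u, g v)"
      by (metis imageE prod.collapse)
    then have "(u, v) \<in> parcs G" using e g(2) G(3) by simp
    then show "e \<in> map_prod g g ` parcs G" using uv(3) by force
  qed
  let ?h = "\<lparr>iso_verts = g, iso_arcs = map_prod g g, iso_head = snd, iso_tail = fst\<rparr>"
  interpret pair_graph G by fact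
  have inj: "inj_on g (pverts G)" using g(1) G(2) by (simp add: bij_betw_def)
  have "inj_on (map_prod g g) (parcs G)"
    using map_prod_inj_on[OF inj inj] pair_graph_arcs(2)[OF G(1)] by (rule inj_on_subset)
  then have "digraph_isomorphism ?h"
    using inj wf_digraph_axioms by (auto simp: digraph_isomorphism_def)
  moreover have "with_proj (extremal_graph n k) = app_iso ?h (with_proj G)"
    using arcs g(1) W(5) G(2) by (simp add: app_iso_def with_proj_def bij_betw_def)
  ultimately show ?thesis unfolding digraph_iso_def by blast
qed

text \<open>The test vector is carried to the numbered vertices along the inverse of the labelling.
  This bounds the spectral radius of the extremal graph from below by vectors on the vertex set of
  any other graph.\<close>

lemma rayleigh_extremal_arcs:
  fixes z :: "'a \<Rightarrow> real"
  assumes fin: "finite C" "finite L" and sub: "S \<subseteq> C" "R \<subseteq> C - S" "C \<inter> L = {}" "a \<in> L"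
    and card: "card S = k" "card R = k - 1" "card L = k + 1" "card C + card L = n"
    and k: "2 \<le> k" "3 * k \<le> n"
  shows "(\<Sum>(u, v)\<in>extremal_arcs C S R L a. z u * z v)
    \<le> graph_spectral_radius (extremal_graph n k) * (\<Sum>v\<in>C \<union> L. (z v)\<^sup>2)"
proof -
  obtain g where g: "bij_betw g (C \<union> L) {0..<n}"
    "\<And>u v. u \<in> C \<union> L \<Longrightarrow> v \<in> C \<union> L \<Longrightarrow>
      (g u, g v) \<in> parcs (extremal_graph n k) \<longleftrightarrow> (u, v) \<in> extremal_arcs C S R L a"
    using extremal_arcs_bij[OF fin sub card k] by blast
  note W = pair_graph_arcs[OF extremal_graph_wf(1)[OF k]] extremal_graph_wf(2)[OF k]
  define h where "h = the_inv_into (C \<union> L) g"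
  have hg: "h (g u) = u" if "u \<in> C \<union> L" for u
    using g(1) that unfolding h_def bij_betw_def by (simp add: the_inv_into_f_f)
  have hb: "bij_betw h {0..<n} (C \<union> L)" unfolding h_def using g(1) by (rule bij_betw_the_inv_into)
  have gh: "g (h i) = i" if "i \<in> {0..<n}" for i
    using g(1) that unfolding h_def bij_betw_def by (auto intro: f_the_inv_into_f)
  have sub2: "extremal_arcs C S R L a \<subseteq> (C \<union> L) \<times> (C \<union> L)" using sub by (auto simp: extremal_arcs_def)
  have "(\<Sum>(i, j)\<in>parcs (extremal_graph n k). z (h i) * z (h j)) = (\<Sum>(u, v)\<in>extremal_arcs C S R L a. z u * z v)"
  proof (rule sum.reindex_bij_witness[of _ "map_prod g g" "map_prod h h"])
    fix e assume e: "e \<in> parcs (extremal_graph n k)"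
    obtain i j where ij: "e = (i, j)" by fastforce
    then have i: "i \<in> {0..<n}" "j \<in> {0..<n}" using e W by auto
    then have hi: "h i \<in> C \<union> L" "h j \<in> C \<union> L" using hb by (auto simp: bij_betw_def)
    show "map_prod g g (map_prod h h e) = e" using gh i ij by simp
    show "map_prod h h e \<in> extremal_arcs C S R L a"
      using g(2)[OF hi] gh i ij e by simp
    show "(case map_prod h h e of (u, v) \<Rightarrow> z u * z v) = (case e of (i, j) \<Rightarrow> z (h i) * z (h j))"
      using ij by simp
  next
    fix e assume e: "e \<in> extremal_arcs C S R L a"
    then obtain u v where uv: "e = (u, v)" "u \<in> C \<union> L" "v \<in> C \<union> L" using sub2 by blast
    show "map_prod h h (map_prod g g e) = e" using hg uv by simp
    show "map_prod g g e \<in> parcs (extremal_graph n k)" using g(2)[OF uv(2,3)] e uv(1) by simp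
  qed
  moreover have "(\<Sum>i\<in>{0..<n}. (z (h i))\<^sup>2) = (\<Sum>v\<in>C \<union> L. (z v)\<^sup>2)"
    by (rule sum.reindex_bij_betw[OF hb])
  moreover have "pverts (extremal_graph n k) \<noteq> {}" using W(5) k by auto
  ultimately show ?thesis
    using rayleigh[OF extremal_graph_wf(1)[OF k], of "z \<circ> h"] W(5) by simp
qed

text \<open>The graph contains a clique on \<open>n - k - 1\<close> vertices, whose indicator serves
  as test vector.\<close>

lemma graph_spectral_radius_extremal_graph_ge:
  assumes k: "2 \<le> k" "3 * k \<le> n"
  shows "real n - real k - 2 \<le> graph_spectral_radius (extremal_graph n k)"
proof -
  define C where "C = {0..<k} \<union> {2 * k + 1..<n}"
  define \<rho> where "\<rho> = graph_spectral_radius (extremal_graph n k)"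
  note W = pair_graph_arcs[OF extremal_graph_wf(1)[OF k]] extremal_graph_wf(2)[OF k]
  have cC: "card C = n - k - 1" using k by (simp add: C_def card_Un_disjoint)
  have finC: "finite C" by (simp add: C_def)
  define z where "z v = (if v \<in> C then 1 else 0 :: real)" for v
  have zz: "(case e of (u, v) \<Rightarrow> z u * z v) = (if e \<in> C \<times> C then 1 else 0)" for e
    by (cases e) (simp add: z_def)
  have C: "C \<subseteq> {0..<n}" using k by (auto simp: C_def)
  have fin: "finite (parcs (extremal_graph n k))" using finite_subset[OF W(2)] W(1) by simp
  have "parcs (extremal_graph n k) \<inter> C \<times> C = C \<times> C - Id_on C"
    unfolding parcs_extremal_graph C_def using k by (intro extremal_arcs_Int_clique) auto
  moreover have "card (C \<times> C - Id_on C) = card C * card C - card C"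
  proof -
    have "Id_on C = (\<lambda>x. (x, x)) ` C" by auto
    then have "card (Id_on C) = card C" "finite (Id_on C)" using finC by (simp_all add: card_image inj_on_def)
    then show ?thesis by (subst card_Diff_subset) (auto simp: card_cartesian_product)
  qed
  moreover have "(\<Sum>(u, v)\<in>parcs (extremal_graph n k). z u * z v) = (\<Sum>e\<in>parcs (extremal_graph n k). if e \<in> C \<times> C then 1 else 0)"
    by (intro sum.cong refl zz)
  ultimately have q: "(\<Sum>(u, v)\<in>parcs (extremal_graph n k). z u * z v) = real (card C * card C - card C)"
    using fin by (simp only: sum.If_cases Collect_mem_eq) simp
  have "(\<Sum>v\<in>{0..<n}. (z v)\<^sup>2) = (\<Sum>v\<in>{0..<n}. if v \<in> C then 1 else 0)"
    by (intro sum.cong) (auto simp: z_def)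
  also have "\<dots> = real (card C)" using C by (simp add: sum.If_cases Int_absorb1)
  finally have d: "(\<Sum>v\<in>{0..<n}. (z v)\<^sup>2) = real (card C)" .
  have "pverts (extremal_graph n k) \<noteq> {}" unfolding W(5) using k by simp
  from rayleigh[OF extremal_graph_wf(1)[OF k] this, of z]
  have "real (card C * card C - card C) \<le> \<rho> * real (card C)"
    unfolding W(5) q d \<rho>_def .
  moreover have "card C * card C - card C = card C * (card C - 1)" by (simp add: diff_mult_distrib2)
  ultimately have "real (card C) * real (card C - 1) \<le> real (card C) * \<rho>" by (metis mult.commute of_nat_mult)
  moreover have "card C > 0" using cC k by simp
  ultimately have "real (card C - 1) \<le> \<rho>" by (metis mult_le_cancel_left_pos of_nat_0_less_iff)
  then show ?thesis using cC k unfolding \<rho>_def by linarith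
qed

subsection \<open>Spectral estimates\<close>

lemma sum_cross_arcs:
  fixes f g :: "'a \<Rightarrow> real"
  assumes "finite A" "finite B" "sym E"
  shows "(\<Sum>u\<in>A. f u * (\<Sum>v\<in>E `` {u} \<inter> B. g v)) = (\<Sum>v\<in>B. g v * (\<Sum>u\<in>E `` {v} \<inter> A. f u))"
proof -
  have 1: "f u * (\<Sum>v\<in>E `` {u} \<inter> B. g v) = (\<Sum>v\<in>B. if (u, v) \<in> E then f u * g v else 0)" for u
  proof -
    have "B \<inter> {v. (u, v) \<in> E} = E `` {u} \<inter> B" by auto
    then show ?thesis using assms(2) by (simp add: sum.If_cases sum_distrib_left)
  qed
  have 2: "g v * (\<Sum>u\<in>E `` {v} \<inter> A. f u) = (\<Sum>u\<in>A. if (u, v) \<in> E then f u * g v else 0)" for v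
  proof -
    have "A \<inter> {u. (u, v) \<in> E} = E `` {v} \<inter> A" using assms(3) by (auto simp: sym_def)
    then show ?thesis using assms(1) by (simp add: sum.If_cases sum_distrib_left mult.commute)
  qed
  show ?thesis unfolding 1 2 by (rule sum.swap)
qed

text \<open>Arcs from \<open>C\<close> to \<open>L\<close> are collected at their ends in
  \<open>L\<close>. The two graphs compared later are thus reduced to their arcs inside
  \<open>C\<close> and the neighbour sums at \<open>L\<close>.\<close>

lemma sum_half_quadratic_form:
  fixes z :: "'a \<Rightarrow> real"
  assumes fin: "finite C" "finite L" and "C \<inter> L = {}" and E: "E \<subseteq> (C \<union> L) \<times> (C \<union> L)" "sym E"
  shows "(\<Sum>u\<in>C. z u * (\<Sum>v\<in>E `` {u}. z v)) =
    (\<Sum>(u, v)\<in>E \<inter> C \<times> C. z u * z v) + (\<Sum>v\<in>L. z v * (\<Sum>u\<in>E `` {v} \<inter> C. z u))"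
proof -
  have "(\<Sum>v\<in>E `` {u}. z v) = (\<Sum>v\<in>E `` {u} \<inter> C. z v) + (\<Sum>v\<in>E `` {u} \<inter> L. z v)" for u
  proof -
    have "E `` {u} = (E `` {u} \<inter> C) \<union> (E `` {u} \<inter> L)" using E by auto
    moreover have "(E `` {u} \<inter> C) \<inter> (E `` {u} \<inter> L) = {}" using assms(3) by auto
    ultimately show ?thesis
      using fin sum.union_disjoint[of "E `` {u} \<inter> C" "E `` {u} \<inter> L" z] by simp
  qed
  then have "(\<Sum>u\<in>C. z u * (\<Sum>v\<in>E `` {u}. z v)) =
    (\<Sum>u\<in>C. z u * (\<Sum>v\<in>E `` {u} \<inter> C. z v)) + (\<Sum>u\<in>C. z u * (\<Sum>v\<in>E `` {u} \<inter> L. z v))"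
    by (simp add: distrib_left sum.distrib)
  also have "(\<Sum>u\<in>C. z u * (\<Sum>v\<in>E `` {u} \<inter> C. z v)) = (\<Sum>(u, v)\<in>E \<inter> C \<times> C. z u * z v)"
  proof -
    have "(E \<inter> C \<times> C) `` {u} = E `` {u} \<inter> C" if "u \<in> C" for u using that by auto
    then show ?thesis
      using sum_arcs[OF fin(1), of "E \<inter> C \<times> C" "\<lambda>u v. z u * z v"] by (simp add: sum_distrib_left)
  qed
  also have "(\<Sum>u\<in>C. z u * (\<Sum>v\<in>E `` {u} \<inter> L. z v)) = (\<Sum>v\<in>L. z v * (\<Sum>u\<in>E `` {v} \<inter> C. z u))"
    by (rule sum_cross_arcs[OF fin E(2)])
  finally show ?thesis .
qed

lemma ex_top_subset:
  fixes x :: "'a \<Rightarrow> real"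
  assumes "finite C" "j \<le> card C"
  shows "\<exists>S\<subseteq>C. card S = j \<and> (\<forall>s\<in>S. \<forall>c\<in>C - S. x c \<le> x s)"
  using assms(2)
proof (induction j)
  case (Suc j)
  then obtain S where S: "S \<subseteq> C" "card S = j" "\<forall>s\<in>S. \<forall>c\<in>C - S. x c \<le> x s" by auto
  have finS: "finite S" using S(1) assms(1) finite_subset by blast
  have ne: "C - S \<noteq> {}" using S Suc.prems by auto
  define m where "m = Max (x ` (C - S))"
  have "m \<in> x ` (C - S)" unfolding m_def using ne assms by (intro Max_in) auto
  then obtain c where c: "c \<in> C - S" "x c = m" by auto
  have "x d \<le> x c" if "d \<in> C - S" for d using that assms c by (simp add: m_def)
  then show ?case
    using S c finS by (intro exI[of _ "insert c S"]) auto
qed (auto intro: exI[of _ "{}"])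

text \<open>Elements of \<open>N - S\<close> are matched with those of \<open>S - N\<close>, whose
  values are at least as large. Exactly \<open>e\<close> elements of \<open>N\<close> stay
  unmatched, each contributing at most 1.\<close>

lemma sum_le_sum_top:
  fixes x :: "'a \<Rightarrow> real"
  assumes fin: "finite S" "finite N" and card: "card N = card S + e"
    and top: "\<And>b s. b \<in> N - S \<Longrightarrow> s \<in> S \<Longrightarrow> x b \<le> x s" and le1: "\<And>b. b \<in> N \<Longrightarrow> x b \<le> 1"
  shows "sum x N \<le> sum x S + e"
proof -
  have "card (N - S) + card (N \<inter> S) = card N" "card (S - N) + card (N \<inter> S) = card S"
    using fin card_Diff_subset_Int[of N S] card_Diff_subset_Int[of S N] card_mono[of N "N \<inter> S"] card_mono[of S "N \<inter> S"]
    by (auto simp: Int_commute)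
  then have c: "card (N - S) = card (S - N) + e" using card by linarith
  then obtain B where B: "B \<subseteq> N - S" "card B = card (S - N)"
    using obtain_subset_with_card_n[of "card (S - N)" "N - S"] by auto
  have finB: "finite B" using B fin by (meson finite_Diff finite_subset)
  obtain h where h: "bij_betw h B (S - N)"
    using finite_same_card_bij[OF finB _ B(2)] fin by blast
  have "sum x B \<le> (\<Sum>b\<in>B. x (h b))"
    using B top bij_betwE[OF h] by (intro sum_mono) auto
  also have "\<dots> = sum x (S - N)" by (rule sum.reindex_bij_betw[OF h])
  finally have 1: "sum x B \<le> sum x (S - N)" .
  have "card (N - S - B) = e" using B c finB by (simp add: card_Diff_subset)
  then have 2: "sum x (N - S - B) \<le> e"
    using sum_mono[of "N - S - B" x "\<lambda>_. 1"] le1 by simp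
  have "sum x N = sum x (N \<inter> S) + sum x (N - S)" using fin by (simp add: sum.Int_Diff)
  also have "sum x (N - S) = sum x B + sum x (N - S - B)"
    using sum.subset_diff[OF B(1), of x] fin by simp
  finally have "sum x N = sum x (N \<inter> S) + sum x B + sum x (N - S - B)" by simp
  moreover have "sum x S = sum x (N \<inter> S) + sum x (S - N)" using fin sum.Int_Diff[of S x N] by (simp add: Int_commute)
  ultimately show ?thesis using 1 2 by linarith
qed

section \<open>Degrees and Perron entries in a graph of large spectral radius\<close>

locale perron_graph =
  fixes V :: "'a set" and E :: "('a \<times> 'a) set" and n k :: nat and \<rho> :: real and x :: "'a \<Rightarrow> real"
  assumes finV: "finite V" and EV: "E \<subseteq> V \<times> V" and symE: "sym E" and irrE: "irrefl E"
    and cardV: "card V = n" and k2: "2 \<le> k" and n1: "k\<^sup>2 + 6 * k + 7 \<le> n" and n2: "20 * k + 10 \<le> n"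
    and min_deg: "\<And>v. v \<in> V \<Longrightarrow> k \<le> card (E `` {v})"
    and x0: "\<And>v. v \<in> V \<Longrightarrow> 0 \<le> x v" and x1: "\<And>v. v \<in> V \<Longrightarrow> x v \<le> 1" and xmax: "\<exists>v\<in>V. x v = 1"
    and eigen: "\<And>u. u \<in> V \<Longrightarrow> (\<Sum>v\<in>E `` {u}. x v) = \<rho> * x u"
    and rho_ge: "real n - real k - 2 \<le> \<rho>"
begin

lemma finN: "finite (E `` {v})"
  using finV EV by (meson finite_Image finite_SigmaI finite_subset)

lemma NV: "E `` {v} \<subseteq> V"
  using EV by auto

lemma rho_bounds: "19 * real k + 8 \<le> \<rho>" "(real k)\<^sup>2 + 5 * real k + 5 \<le> \<rho>" "0 < \<rho>"
proof -
  have "real (k\<^sup>2 + 6 * k + 7) \<le> real n" "real (20 * k + 10) \<le> real n"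
    using n1 n2 by (simp_all only: of_nat_le_iff)
  then show "19 * real k + 8 \<le> \<rho>" "(real k)\<^sup>2 + 5 * real k + 5 \<le> \<rho>" using rho_ge by simp_all
  then show "0 < \<rho>" by linarith
qed

text \<open>The entries sum to at least \<open>\<rho> + 1\<close>: the maximal one is 1, and its
  neighbours contribute \<open>\<rho>\<close>.\<close>

lemma sum_deficit: "(\<Sum>v\<in>V. 1 - x v) \<le> real k + 1"
proof -
  obtain u where u: "u \<in> V" "x u = 1" using xmax by blast
  have "\<rho> = (\<Sum>v\<in>E `` {u}. x v)" using eigen[OF u(1)] u(2) by simp
  also have "\<dots> \<le> (\<Sum>v\<in>V - {u}. x v)"
    using finV NV[of u] irrE x0 by (intro sum_mono2) (auto simp: irrefl_def)
  finally have "\<rho> + 1 \<le> (\<Sum>v\<in>V. x v)" using sum.remove[OF finV u(1), of x] u(2) by simp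
  moreover have "(\<Sum>v\<in>V. 1 - x v) = real n - (\<Sum>v\<in>V. x v)" using cardV by (simp add: sum_subtractf)
  ultimately show ?thesis using rho_ge by linarith
qed

lemma rho_x_le_degree: "v \<in> V \<Longrightarrow> \<rho> * x v \<le> card (E `` {v})"
  using sum_mono[of "E `` {v}" x "\<lambda>_. 1"] x1 NV[of v] by (auto simp: eigen[symmetric])

text \<open>A Markov inequality: each counted vertex uses at least \<open>\<rho> - d\<close> of the
  total budget \<open>(k + 1) * \<rho>\<close> for \<open>\<rho> * (1 - x v)\<close>.\<close>

lemma card_low_degrees_mult_le:
  assumes "real d \<le> \<rho>"
  shows "card {v \<in> V. card (E `` {v}) \<le> d} * (\<rho> - d) \<le> (real k + 1) * \<rho>"
proof -
  let ?A = "{v \<in> V. card (E `` {v}) \<le> d}"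
  have "card ?A * (\<rho> - d) = (\<Sum>v\<in>?A. \<rho> - d)" by simp
  also have "\<dots> \<le> (\<Sum>v\<in>?A. \<rho> * (1 - x v))"
  proof (rule sum_mono)
    fix v assume "v \<in> ?A"
    then have "\<rho> * x v \<le> d" using rho_x_le_degree[of v] by force
    then show "\<rho> - d \<le> \<rho> * (1 - x v)" by (simp add: algebra_simps)
  qed
  also have "\<dots> \<le> (\<Sum>v\<in>V. \<rho> * (1 - x v))"
    using finV x1 rho_bounds(3) by (intro sum_mono2) auto
  also have "\<dots> = \<rho> * (\<Sum>v\<in>V. 1 - x v)" by (simp add: sum_distrib_left)
  also have "\<dots> \<le> \<rho> * (real k + 1)" using sum_deficit rho_bounds(3) by simp
  finally show ?thesis by (simp add: mult.commute)
qed

text \<open>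
  If there were \<open>k + 2\<close> such vertices, then summing the eigenvalue equation over the others would force
  these \<open>k + 2\<close> entries of \<open>x\<close> to be too large.
\<close>

lemma card_very_low_degrees: "card {v \<in> V. card (E `` {v}) \<le> 4 * k} \<le> k + 1"
proof (rule ccontr)
  assume "\<not> ?thesis"
  then obtain T where T: "T \<subseteq> {v \<in> V. card (E `` {v}) \<le> 4 * k}" "card T = k + 2"
    using obtain_subset_with_card_n[of "k + 2" "{v \<in> V. card (E `` {v}) \<le> 4 * k}"] by auto
  have TV: "T \<subseteq> V" using T by auto
  have finT: "finite T" using TV finV finite_subset by blast
  define C where "C = V - T"
  have finC: "finite C" using finV by (simp add: C_def)
  have cC: "card C + k + 2 = n" using card_Diff_subset[OF finT TV] card_mono[OF finV TV] T(2) cardV by (simp add: C_def)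
  have VCT: "V = C \<union> T" "C \<inter> T = {}" using TV by (auto simp: C_def)
  define X where "X = (\<Sum>v\<in>C. x v)"
  define Y where "Y = (\<Sum>v\<in>T. x v)"
  have sumV: "(\<Sum>v\<in>V. f v) = (\<Sum>v\<in>C. f v) + (\<Sum>v\<in>T. f v)" for f :: "'a \<Rightarrow> real"
    using VCT finC finT by (simp add: sum.union_disjoint)
  have X0: "0 \<le> X" unfolding X_def using x0 VCT by (intro sum_nonneg) auto
  have "\<rho> * X = (\<Sum>u\<in>C. 1 * (\<Sum>v\<in>E `` {u} \<inter> V. x v))"
    unfolding X_def sum_distrib_left using eigen NV VCT by (intro sum.cong) (auto simp: Int_absorb2)
  also have "\<dots> = (\<Sum>v\<in>V. x v * (\<Sum>u\<in>E `` {v} \<inter> C. 1))"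
    by (rule sum_cross_arcs[OF finC finV symE])
  also have "\<dots> = (\<Sum>v\<in>C. x v * card (E `` {v} \<inter> C)) + (\<Sum>v\<in>T. x v * card (E `` {v} \<inter> C))"
    by (simp add: sumV)
  \<comment> \<open>A vertex of \<open>C\<close> has at most \<open>card C - 1 = n - k - 3\<close>
    neighbours in \<open>C\<close>, one less than the lower bound for \<open>\<rho>\<close>. That
    difference of one yields \<open>X \<le> 4 * k * Y\<close> below.\<close>
  also have "\<dots> \<le> (\<Sum>v\<in>C. x v * (real n - k - 3)) + (\<Sum>v\<in>T. x v * (4 * k))"
  proof (intro add_mono sum_mono mult_left_mono)
    fix v assume v: "v \<in> C"
    then show "0 \<le> x v" using x0 VCT by auto
    have "card (E `` {v} \<inter> C) \<le> card (C - {v})"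
      using irrE finC by (intro card_mono) (auto simp: irrefl_def)
    also have "\<dots> = card C - 1" using v finC by simp
    finally have "card (E `` {v} \<inter> C) \<le> card C - 1" .
    moreover have "0 < card C" using v finC by (auto simp: card_gt_0_iff)
    ultimately show "real (card (E `` {v} \<inter> C)) \<le> real n - k - 3" using cC by linarith
  next
    fix v assume v: "v \<in> T"
    then show "0 \<le> x v" using x0 VCT by auto
    have "card (E `` {v} \<inter> C) \<le> card (E `` {v})" using finN by (intro card_mono) auto
    also have "\<dots> \<le> 4 * k" using v T by auto
    finally show "real (card (E `` {v} \<inter> C)) \<le> real (4 * k)" by (simp only: of_nat_le_iff)
  qed
  also have "\<dots> = X * (real n - k - 3) + Y * (4 * k)"
    unfolding X_def Y_def by (simp add: sum_distrib_right)
  finally have "\<rho> * X \<le> X * (real n - k - 3) + Y * (4 * k)" .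
  moreover have "(real n - k - 2) * X \<le> \<rho> * X" using rho_ge X0 by (intro mult_right_mono) auto
  ultimately have "X \<le> 4 * k * Y" by (simp add: algebra_simps)
  moreover have "(\<Sum>v\<in>V. 1 - x v) = real n - (X + Y)"
    using cardV sumV[of x] by (simp add: sum_subtractf X_def Y_def)
  ultimately have Y: "real n - k - 1 \<le> (4 * k + 1) * Y" using sum_deficit by (simp add: algebra_simps)
  have "\<rho> * Y = (\<Sum>v\<in>T. \<rho> * x v)" by (simp add: Y_def sum_distrib_left)
  also have "\<dots> \<le> (\<Sum>v\<in>T. real (4 * k))"
  proof (rule sum_mono)
    fix v assume "v \<in> T"
    then show "\<rho> * x v \<le> real (4 * k)" using T rho_x_le_degree[of v] by force
  qed
  finally have rY: "\<rho> * Y \<le> (k + 2) * (4 * k)" using T(2) by (simp add: algebra_simps)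
  define m where "m = real n - k - 2"
  have "real (k\<^sup>2 + 6 * k + 7) \<le> real n" "real (20 * k + 10) \<le> real n"
    using n1 n2 by (simp_all only: of_nat_le_iff)
  then have m: "19 * real k + 8 \<le> m" "(real k)\<^sup>2 + 5 * real k + 5 \<le> m" by (simp_all add: m_def)
  \<comment> \<open>The lower and upper bounds for \<open>Y\<close> combine to an upper bound for
    \<open>m * (m + 1)\<close> that is cubic in \<open>k\<close>. The product of the linear and the
    quadratic lower bound for \<open>m\<close> already exceeds it.\<close>
  have "m * (m + 1) \<le> \<rho> * (m + 1)" using rho_ge m by (intro mult_right_mono) (auto simp: m_def)
  also have "\<dots> \<le> \<rho> * ((4 * k + 1) * Y)" using Y rho_bounds(3) by (simp add: m_def)
  also have "\<dots> = (4 * k + 1) * (\<rho> * Y)" by simp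
  also have "\<dots> \<le> real (4 * k + 1) * real ((k + 2) * (4 * k))" using rY by (rule mult_left_mono) simp
  finally have "m * (m + 1) \<le> (4 * real k + 1) * ((real k + 2) * (4 * real k))" by (simp add: algebra_simps)
  moreover have "(19 * real k + 8) * ((real k)\<^sup>2 + 5 * real k + 5) \<le> m * m"
    using m by (intro mult_mono) auto
  moreover have "(19 * real k + 8) * ((real k)\<^sup>2 + 5 * real k + 5)
    = (4 * real k + 1) * ((real k + 2) * (4 * real k)) + 3 * (real k)^3 + 67 * (real k)\<^sup>2 + 127 * real k + 40"
    by (simp add: algebra_simps power2_eq_square power3_eq_cube)
  moreover have "0 < m" using m(1) by linarith
  moreover have "m * (m + 1) = m * m + m" by (simp add: algebra_simps)
  moreover have "0 \<le> (real k) ^ 3" "0 \<le> (real k)\<^sup>2" "0 \<le> real k" by simp_all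
  ultimately show False by linarith
qed

text \<open>This supplies the hypothesis \<open>deg\<close> of the factor lemma, with the degree as
  \<open>\<phi>\<close>. A degree up to \<open>3 / 4 * \<rho>\<close> exceeds the number of vertices
  of no larger degree by at least \<open>2 * k + 1\<close>, by the Markov bound; a larger degree
  exceeds half the order sufficiently.\<close>

lemma degree_condition:
  fixes L
  defines "L \<equiv> {v \<in> V. card (E `` {v}) \<le> 4 * k}"
  assumes u: "u \<in> V - L"
  shows "card {w \<in> V - L. card (E `` {w}) \<le> card (E `` {u})} + k + card L \<le> card (E `` {u} - L) \<or>
      card (V - L) + card L + 2 * k \<le> 2 * card (E `` {u} - L) + 1"
proof -
  define d where "d = card (E `` {u})"
  define N where "N = card {v \<in> V. card (E `` {v}) \<le> d}"
  have finL: "finite L" and LV: "L \<subseteq> V" using finV by (auto simp: L_def)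
  have t: "card L \<le> k + 1" unfolding L_def by (rule card_very_low_degrees)
  have d: "4 * k + 1 \<le> d" using u by (auto simp: L_def d_def)
  have cV: "card (V - L) + card L = n"
    using card_mono[OF finV LV] card_Diff_subset[OF finL LV] cardV by simp
  have "d \<le> card ((E `` {u} - L) \<union> L)" unfolding d_def using finN finL by (intro card_mono) auto
  also have "\<dots> \<le> card (E `` {u} - L) + card L" by (rule card_Un_le)
  finally have dL: "d \<le> card (E `` {u} - L) + card L" .
  show ?thesis
  proof (cases "real d \<le> 3 / 4 * \<rho>")
    case True
    have "{w \<in> V - L. card (E `` {w}) \<le> d} \<union> L \<subseteq> {v \<in> V. card (E `` {v}) \<le> d}"
      using d by (auto simp: L_def)
    then have "card ({w \<in> V - L. card (E `` {w}) \<le> d} \<union> L) \<le> N"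
      unfolding N_def using finV by (intro card_mono) auto
    moreover have "card ({w \<in> V - L. card (E `` {w}) \<le> d} \<union> L) = card {w \<in> V - L. card (E `` {w}) \<le> d} + card L"
      using finV finL by (intro card_Un_disjoint) auto
    ultimately have N: "card {w \<in> V - L. card (E `` {w}) \<le> d} + card L \<le> N" by simp
    note r = rho_bounds
    have r4: "0 < \<rho> - d" using True r(3) by linarith
    have "real N * (\<rho> - d) \<le> (real k + 1) * \<rho>"
      unfolding N_def using card_low_degrees_mult_le[of d] True r(3) by simp
    \<comment> \<open>Both factors on the right are bounded separately on three ranges of
      \<open>d\<close>. The threshold \<open>4 * k\<close> in \<open>L\<close> enters in the first,
      where it gives \<open>d - 2 * k - 1 \<ge> 2 * k\<close>.\<close>
    also have "(real k + 1) * \<rho> \<le> (real d - 2 * k - 1) * (\<rho> - d)"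
    proof -
      have k2': "2 \<le> real k" using k2 by simp
      have d': "4 * real k + 1 \<le> real d" using d by simp
      consider "d \<le> \<rho> / 4" | "\<rho> / 4 \<le> d" "d \<le> \<rho> / 2" | "\<rho> / 2 \<le> d" by linarith
      then show ?thesis
      proof cases
        case 1
        have "(2 * real k) * (3 / 4 * \<rho>) \<le> (real d - 2 * k - 1) * (\<rho> - d)"
          using 1 d' r(3) by (intro mult_mono) auto
        moreover have "(real k + 1) * \<rho> \<le> (3 / 2 * real k) * \<rho>" using k2' r(3) by (intro mult_right_mono) auto
        ultimately show ?thesis by (simp add: algebra_simps)
      next
        case 2
        have "(\<rho> / 4 - 2 * k - 1) * (\<rho> / 2) \<le> (real d - 2 * k - 1) * (\<rho> - d)"
          using 2 d' r k2' by (intro mult_mono) auto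
        moreover have "(real k + 1) * \<rho> \<le> ((\<rho> / 4 - 2 * k - 1) / 2) * \<rho>" using k2' r by (intro mult_right_mono) auto
        ultimately show ?thesis by (simp add: algebra_simps)
      next
        case 3
        have "(\<rho> / 2 - 2 * k - 1) * (\<rho> / 4) \<le> (real d - 2 * k - 1) * (\<rho> - d)"
          using 3 True d' r k2' by (intro mult_mono) auto
        moreover have "(real k + 1) * \<rho> \<le> ((\<rho> / 2 - 2 * k - 1) / 4) * \<rho>" using k2' r by (intro mult_right_mono) auto
        ultimately show ?thesis by (simp add: algebra_simps)
      qed
    qed
    finally have "real N \<le> real d - 2 * k - 1" using r4 by simp
    then show ?thesis using N t dL by (simp add: d_def)
  next
    case False
    then have "3 * \<rho> < 4 * real d" by simp
    moreover have "3 * (real n - real k - 2) \<le> 3 * \<rho>" using rho_ge by simp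
    ultimately have "3 * (real n - real k - 2) < 4 * real d" by (rule le_less_trans[rotated])
    then have "3 * n < 4 * d + 3 * k + 6" by simp
    then have "n + 4 * k + 1 \<le> 2 * d" using n2 by linarith
    then show ?thesis using cV t dL by linarith
  qed
qed

text \<open>Two Rayleigh comparisons with the extremal graph on the same vertices. If one vertex of
  \<open>L\<close> has excess \<open>k - 1\<close>, then \<open>x\<close> itself as test vector
  rules out any missing edge. If not, a vector modified on \<open>L\<close> contradicts
  \<open>rho\<close>.\<close>

lemma few_excess_edges_extremal:
  assumes L: "L \<subseteq> V" "card L = k + 1"
    and U: "U = {u \<in> V - L. \<forall>v\<in>L. (v, u) \<in> E}"
    and few: "(\<Sum>v\<in>L. card (E `` {v}) - k) < card U"
    and rho: "graph_spectral_radius (extremal_graph n k) \<le> \<rho>"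
  shows "\<exists>S R a. S \<subseteq> V - L \<and> R \<subseteq> V - L - S \<and> a \<in> L \<and> card S = k \<and> card R = k - 1 \<and>
    E = extremal_arcs (V - L) S R L a"
proof -
  define C where "C = V - L"
  define e where "e v = card (E `` {v}) - k" for v
  have finL: "finite L" using L finV finite_subset by blast
  have finC: "finite C" using finV by (simp add: C_def)
  have VCL: "V = C \<union> L" "C \<inter> L = {}" using L by (auto simp: C_def)
  have cCL: "card C + card L = n" using VCL card_Un_disjoint[OF finC finL] cardV by simp
  have cC: "card C + k + 1 = n" using cCL L(2) by simp
  have k3: "3 * k \<le> n" using n2 by simp
  have sumV: "(\<Sum>v\<in>V. f v) = (\<Sum>v\<in>C. f v) + (\<Sum>v\<in>L. f v)" for f :: "'a \<Rightarrow> real"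
    using VCL finC finL by (simp add: sum.union_disjoint)
  have deg: "card (E `` {v}) = k + e v" if "v \<in> L" for v
    using min_deg[of v] that L by (auto simp: e_def)
  have UE: "U \<subseteq> E `` {v}" if "v \<in> L" for v using U that by auto
  have UC: "U \<subseteq> C" by (auto simp: U C_def)
  \<comment> \<open>If \<open>U\<close> had \<open>k + j + 1\<close> elements, each of the
    \<open>k + 1\<close> vertices of \<open>L\<close> would have excess at least
    \<open>j + 1\<close>, in total no less than \<open>card U\<close>.\<close>
  have cU: "card U \<le> k"
  proof (rule ccontr)
    assume nU: "\<not> card U \<le> k"
    have "card U - k \<le> e v" if "v \<in> L" for v
      using card_mono[OF finN UE[OF that]] deg[OF that] by linarith
    then have "(\<Sum>v\<in>L. card U - k) \<le> (\<Sum>v\<in>L. e v)" by (intro sum_mono) auto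
    then have j: "(k + 1) * (card U - k) < card U" using few L(2) by (simp add: e_def)
    obtain j where U': "card U = k + Suc j" using nU by (metis less_imp_Suc_add not_le add_Suc_right)
    show False using j unfolding U' by simp
  qed
  have sum_e: "(\<Sum>v\<in>L. e v) + 1 \<le> k" using few cU by (simp add: e_def)
  have e_le: "e v + 1 \<le> k" if "v \<in> L" for v using member_le_sum[of v L e] finL that sum_e by simp
  have rx: "\<rho> * x v \<le> real k + e v" if "v \<in> L" for v
    using rho_x_le_degree[of v] that L deg[OF that] by auto
  define Y where "Y = (\<Sum>v\<in>L. x v)"
  have rY: "\<rho> * Y \<le> (real k)\<^sup>2 + 2 * k - 1"
  proof -
    have "\<rho> * Y \<le> (\<Sum>v\<in>L. real k + e v)" unfolding Y_def sum_distrib_left using rx by (rule sum_mono)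
    also have "\<dots> = (real k + 1) * k + real (\<Sum>v\<in>L. e v)" using L(2) by (simp add: sum.distrib)
    also have "real (\<Sum>v\<in>L. e v) \<le> real k - 1" using sum_e by linarith
    finally show ?thesis by (simp add: algebra_simps power2_eq_square)
  qed
  then have "\<rho> * Y < \<rho> * 1" using rho_bounds(2) by (simp add: algebra_simps)
  then have Y1: "Y < 1" using rho_bounds(3) by simp
  \<comment> \<open>Since \<open>Y\<close> is small, \<open>L\<close> uses almost the whole budget
    \<open>k + 1\<close> of \<open>sum_deficit\<close>; all entries on \<open>C\<close> are
    therefore close to 1.\<close>
  have defC: "(\<Sum>v\<in>C. 1 - x v) \<le> Y"
  proof -
    have "(\<Sum>v\<in>C. 1 - x v) + (\<Sum>v\<in>L. 1 - x v) \<le> k + 1" using sum_deficit by (simp add: sumV)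
    moreover have "(\<Sum>v\<in>L. 1 - x v) = real k + 1 - Y" using L(2) by (simp add: sum_subtractf Y_def)
    ultimately show ?thesis by linarith
  qed
  have xC: "1 - Y \<le> x c" if "c \<in> C" for c
  proof -
    have "1 - x c \<le> (\<Sum>v\<in>C. 1 - x v)" using finC x1 VCL that by (intro member_le_sum) auto
    then show ?thesis using defC by linarith
  qed
  have posC: "0 < x c" if "c \<in> C" for c using xC[OF that] Y1 by linarith
  \<comment> \<open>\<open>\<rho> * x w\<close> is at most \<open>2 * k - 1\<close>, while
    \<open>\<rho> * (1 - Y)\<close> is at least \<open>\<rho> - (k\<^sup>2 + 2 * k - 1)\<close>. The
    quadratic lower bound for \<open>\<rho>\<close> separates the two.\<close>
  have LC: "x w \<le> x c" if "w \<in> L" "c \<in> C" for w c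
  proof -
    have "real (e w) + 1 \<le> k" using e_le[OF that(1)] by linarith
    then have "\<rho> * x w \<le> 2 * real k - 1" using rx[OF that(1)] by linarith
    also have "\<dots> \<le> \<rho> - \<rho> * Y" using rY rho_bounds(2) k2 by (simp add: algebra_simps)
    also have "\<dots> = \<rho> * (1 - Y)" by (simp add: algebra_simps)
    also have "\<dots> \<le> \<rho> * x c" using xC[OF that(2)] rho_bounds(3) by simp
    finally show ?thesis using rho_bounds(3) by simp
  qed
  show ?thesis
  proof (cases "\<exists>a\<in>L. e a + 1 = k")
    case True
    then obtain a where a: "a \<in> L" "e a + 1 = k" by blast
    have "(\<Sum>v\<in>L - {a}. e v) = 0" using sum.remove[OF finL a(1), of e] a(2) sum_e by simp
    then have e0: "e v = 0" if "v \<in> L" "v \<noteq> a" for v using that finL by simp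
    have "e a \<le> (\<Sum>v\<in>L. e v)" using finL a by (intro member_le_sum) auto
    then have cUk: "card U = k" using few cU a(2) by (simp add: e_def)
    \<comment> \<open>The excess \<open>k - 1\<close> of \<open>a\<close> exhausts the total, so all
      other vertices of \<open>L\<close> have degree \<open>k\<close> and contain the
      \<open>k\<close> vertices of \<open>U\<close> in their neighbourhood.\<close>
    have NU: "E `` {v} = U" if "v \<in> L" "v \<noteq> a" for v
      using card_subset_eq[OF finN UE[OF that(1)]] deg[OF that(1)] e0[OF that] cUk by simp
    define R where "R = E `` {a} - U"
    have finU: "finite U" using UC finC finite_subset by blast
    have cR: "card R = k - 1"
      unfolding R_def using card_Diff_subset[OF finU UE[OF a(1)]] deg[OF a(1)] a(2) cUk by simp
    have aL: "v \<notin> L" if "(a, v) \<in> E" for v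
    proof
      assume v: "v \<in> L"
      have "v \<noteq> a" "(v, a) \<in> E" using that irrE symE by (auto simp: irrefl_def sym_def)
      then have "a \<in> U" using NU[OF v] by auto
      then show False using UC VCL a(1) by auto
    qed
    have RC: "R \<subseteq> C - U" using aL NV[of a] by (auto simp: R_def C_def)
    let ?X = "extremal_arcs C U R L a"
    have sub: "E \<subseteq> ?X"
    proof
      fix p assume p: "p \<in> E"
      obtain u v where uv: "p = (u, v)" by fastforce
      have uvE: "(u, v) \<in> E" "(v, u) \<in> E" "u \<noteq> v" "u \<in> V" "v \<in> V"
        using p uv symE irrE EV by (auto simp: sym_def irrefl_def)
      have N: "w' \<in> U \<or> w = a \<and> w' \<in> R" if "w \<in> L" "(w, w') \<in> E" for w w'
        using NU[of w] that by (cases "w = a") (auto simp: R_def)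
      show "p \<in> ?X"
        using uvE N[of u v] N[of v u] VCL unfolding uv extremal_arcs_iff by blast
    qed
    \<comment> \<open>Arcs missing from \<open>E\<close> can only join two vertices of
      \<open>C\<close>, where \<open>x\<close> is positive. A missing arc would make the quadratic
      form strictly larger.\<close>
    have super: "u \<in> C \<and> v \<in> C" if "(u, v) \<in> ?X" "(u, v) \<notin> E" for u v
    proof -
      have "(w, w') \<in> E \<and> (w', w) \<in> E" if "w \<in> L" "w' \<in> U" for w w'
        using UE[OF that(1)] that(2) symE by (auto simp: sym_def)
      moreover have "(a, w) \<in> E \<and> (w, a) \<in> E" if "w \<in> R" for w
        using that symE by (auto simp: R_def sym_def)
      ultimately show ?thesis using that unfolding extremal_arcs_iff by blast
    qed
    have "E = ?X"
    proof (rule ccontr)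
      assume "E \<noteq> ?X"
      then obtain p where p: "p \<in> ?X - E" using sub by blast
      obtain u v where uv: "p = (u, v)" by fastforce
      have "?X \<subseteq> V \<times> V" using UC RC a VCL by (auto simp: extremal_arcs_def)
      then have finX: "finite ?X" using finV by (meson finite_SigmaI finite_subset)
      have X: "(\<Sum>(u, v)\<in>?X. x u * x v) = (\<Sum>(u, v)\<in>E. x u * x v) + (\<Sum>(u, v)\<in>?X - E. x u * x v)"
        using sum.subset_diff[OF sub finX] by (simp add: add.commute)
      have pos: "0 < (case q of (u, v) \<Rightarrow> x u * x v)" if "q \<in> ?X - E" for q
        using super[of "fst q" "snd q"] posC that by (cases q) auto
      have "0 < (\<Sum>(u, v)\<in>?X - E. x u * x v)"
        using finX p pos by (intro sum_pos2[of _ p]) (auto intro: less_imp_le)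
      moreover have "(\<Sum>(u, v)\<in>E. x u * x v) = \<rho> * (\<Sum>v\<in>V. (x v)\<^sup>2)"
      proof -
        have "(\<Sum>(u, v)\<in>E. x u * x v) = (\<Sum>u\<in>V. x u * (\<Sum>v\<in>E `` {u}. x v))"
          using sum_arcs[OF finV EV, of "\<lambda>u v. x u * x v"] by (simp add: sum_distrib_left)
        then show ?thesis using eigen by (simp add: sum_distrib_left power2_eq_square algebra_simps)
      qed
      moreover have "(\<Sum>(u, v)\<in>?X. x u * x v) \<le> graph_spectral_radius (extremal_graph n k) * (\<Sum>v\<in>V. (x v)\<^sup>2)"
        unfolding VCL(1)
        by (rule rayleigh_extremal_arcs[OF finC finL UC RC VCL(2) a(1) cUk cR L(2) cCL k2 k3])
      moreover have "graph_spectral_radius (extremal_graph n k) * (\<Sum>v\<in>V. (x v)\<^sup>2) \<le> \<rho> * (\<Sum>v\<in>V. (x v)\<^sup>2)"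
        using rho by (intro mult_right_mono sum_nonneg) auto
      ultimately show False using X by linarith
    qed
    then show ?thesis
      using UC RC a(1) cUk cR unfolding C_def by blast
  next
    case False
    then have e_le2: "e v + 2 \<le> k" if "v \<in> L" for v using e_le[OF that] that by fastforce
    \<comment> \<open>\<open>S\<close> holds the \<open>k\<close> largest entries on
      \<open>C\<close>, and \<open>R\<close> the next \<open>k - 1\<close>. The competitor is the
      extremal graph built on them, with an arbitrary \<open>a\<close> in \<open>L\<close>.\<close>
    obtain S where S: "S \<subseteq> C" "card S = k" "\<And>s c. s \<in> S \<Longrightarrow> c \<in> C - S \<Longrightarrow> x c \<le> x s"
    proof -
      have "k \<le> card C" using cC n2 by linarith
      from ex_top_subset[OF finC this, of x] show thesis using that by blast
    qed
    have finS: "finite S" using S finC finite_subset by blast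
    have cCS: "card (C - S) + 2 * k + 1 = n"
      using card_Diff_subset[OF finS S(1)] card_mono[OF finC S(1)] S(2) cC by simp
    obtain R where R: "R \<subseteq> C - S" "card R = k - 1" "\<And>r c. r \<in> R \<Longrightarrow> c \<in> C - S - R \<Longrightarrow> x c \<le> x r"
    proof -
      have "k - 1 \<le> card (C - S)" using cCS n2 by linarith
      from ex_top_subset[OF finite_Diff[OF finC] this, of x] show thesis using that by blast
    qed
    have finR: "finite R" using R finC by (meson finite_Diff finite_subset)
    have "L \<noteq> {}" using L(2) by auto
    then obtain a where a: "a \<in> L" by blast
    define s where "s = sum x S"
    define r where "r = sum x R"
    have s: "0 \<le> s" "s \<le> k"
      using sum_nonneg[of S x] sum_mono[of S x "\<lambda>_. 1"] x0 x1 S VCL by (auto simp: s_def subset_iff)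
    \<comment> \<open>An entry of \<open>R\<close> below this bound would force the same deficit on
      all \<open>n - 3 * k\<close> vertices after \<open>R\<close>. Their total would be at least 1,
      since \<open>n\<close> is at least \<open>11 * k\<close>.\<close>
    have xR: "1 - 1 / (8 * real k) \<le> x c" if c: "c \<in> R" for c
    proof (rule ccontr)
      assume "\<not> ?thesis"
      then have lt: "1 / (8 * real k) \<le> 1 - x c" by linarith
      have cD: "card (C - S - R) + 3 * k = n"
        using card_Diff_subset[OF finR R(1)] card_mono[OF _ R(1)] R(2) cCS k2 finC by simp
      have "(\<Sum>v\<in>C - S - R. 1 / (8 * real k)) \<le> (\<Sum>v\<in>C - S - R. 1 - x v)"
        using R(3)[OF c] lt by (intro sum_mono) force
      also have "\<dots> \<le> (\<Sum>v\<in>C. 1 - x v)" using finC x1 VCL by (intro sum_mono2) auto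
      also have "\<dots> < 1" using defC Y1 by linarith
      finally have "real (card (C - S - R)) < 8 * real k" using k2 by (simp add: field_simps)
      then show False using cD n2 by linarith
    qed
    have r: "(real k - 1) * (1 - 1 / (8 * real k)) \<le> r"
      using sum_mono[of R "\<lambda>_. 1 - 1 / (8 * real k)" x] xR R(2) k2 by (simp add: r_def of_nat_diff)
    \<comment> \<open>By \<open>LC\<close> the entries on \<open>S\<close> dominate all others,
      those on \<open>L\<close> included. A neighbourhood of \<open>k + e v\<close> vertices thus
      has sum at most \<open>s + e v\<close>.\<close>
    have g: "\<rho> * x v \<le> s + e v" if v: "v \<in> L" for v
    proof -
      have "sum x (E `` {v}) \<le> sum x S + e v"
      proof (rule sum_le_sum_top[OF finS finN])
        show "card (E `` {v}) = card S + e v" using deg[OF v] S(2) by simp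
        fix b assume "b \<in> E `` {v}"
        then show "x b \<le> 1" using x1 NV by blast
      next
        fix b t assume bt: "b \<in> E `` {v} - S" "t \<in> S"
        then have "b \<in> C - S \<or> b \<in> L" using NV[of v] VCL by auto
        then show "x b \<le> x t" using S bt LC by blast
      qed
      then show ?thesis using eigen[of v] v L by (auto simp: s_def)
    qed
    \<comment> \<open>Each excess is at most \<open>k - 2\<close> and their sum at most
      \<open>k - 1\<close>, so the squares of the excesses sum to at most
      \<open>(k - 2) * (k - 1)\<close>.\<close>
    have upper: "(\<Sum>v\<in>L. (\<rho> * x v)\<^sup>2) \<le> (real k + 1) * s\<^sup>2 + 2 * s * (real k - 1) + (real k - 2) * (real k - 1)"
    proof -
      have "(\<rho> * x v)\<^sup>2 \<le> s\<^sup>2 + 2 * s * e v + (real k - 2) * e v" if v: "v \<in> L" for v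
      proof -
        have "(\<rho> * x v)\<^sup>2 \<le> (s + e v)\<^sup>2"
          using g[OF v] rho_bounds(3) x0[of v] v L by (intro power_mono mult_nonneg_nonneg) auto
        also have "\<dots> = s\<^sup>2 + 2 * s * e v + real (e v) * real (e v)" by (simp add: power2_eq_square algebra_simps)
        also have "real (e v) * real (e v) \<le> (real k - 2) * e v"
          using e_le2[OF v] by (intro mult_right_mono) linarith+
        finally show ?thesis by simp
      qed
      then have "(\<Sum>v\<in>L. (\<rho> * x v)\<^sup>2) \<le> (\<Sum>v\<in>L. s\<^sup>2 + 2 * s * e v + (real k - 2) * e v)" by (rule sum_mono)
      also have "\<dots> = (real k + 1) * s\<^sup>2 + (2 * s) * real (\<Sum>v\<in>L. e v) + (real k - 2) * real (\<Sum>v\<in>L. e v)"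
        using L(2) by (simp add: sum.distrib sum_distrib_left)
      also have "\<dots> \<le> (real k + 1) * s\<^sup>2 + (2 * s) * (real k - 1) + (real k - 2) * (real k - 1)"
      proof -
        have "real (\<Sum>v\<in>L. e v) \<le> real k - 1" using sum_e by linarith
        then show ?thesis using s(1) k2 by (intro add_mono mult_left_mono) auto
      qed
      finally show ?thesis by simp
    qed
    \<comment> \<open>If \<open>r\<close> were \<open>k - 1\<close>, the right side would be ahead
      by \<open>k - 1\<close>. Replacing \<open>r\<close> by its lower bound \<open>q\<close> costs
      at most \<open>(k - 1) / 4\<close> in the mixed term and less than that in the square.\<close>
    have gap: "2 * s * (real k - 1) + (real k - 2) * (real k - 1) < 2 * s * r + r\<^sup>2"
    proof -
      define q where "q = (real k - 1) * (1 - 1 / (8 * real k))"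
      have kk: "2 \<le> real k" using k2 by simp
      have q0: "0 \<le> q" unfolding q_def using kk by (intro mult_nonneg_nonneg) (auto simp: field_simps)
      have qr: "q \<le> r" using r by (simp add: q_def)
      have "2 * s * q + q\<^sup>2 \<le> 2 * s * r + r\<^sup>2"
        using q0 qr s(1) by (intro add_mono mult_left_mono power_mono) auto
      moreover have "2 * s * (real k - 1) - 2 * s * q \<le> (real k - 1) / 4"
      proof -
        have "2 * s * (real k - 1) - 2 * s * q = s * ((real k - 1) / (4 * real k))"
          using kk by (simp add: q_def field_simps)
        also have "\<dots> \<le> real k * ((real k - 1) / (4 * real k))"
          using s kk by (intro mult_right_mono) auto
        also have "\<dots> = (real k - 1) / 4" using kk by simp
        finally show ?thesis .
      qed
      moreover have "(real k - 2) * (real k - 1) + (real k - 1) / 4 < q\<^sup>2"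
      proof -
        have "(real k - 2) * (real k - 1) + (real k - 1) / 4 < (real k - 1)\<^sup>2 - (real k - 1) * (1 / 4)"
          using kk by (simp add: power2_eq_square field_simps)
        also have "\<dots> \<le> (real k - 1)\<^sup>2 - (real k - 1) * ((real k - 1) / (4 * real k))"
          using kk by (intro diff_left_mono mult_left_mono) (auto simp: field_simps)
        also have "\<dots> = (real k - 1)\<^sup>2 * (1 - 1 / (4 * real k))"
          using kk by (simp add: power2_eq_square field_simps)
        also have "\<dots> \<le> (real k - 1)\<^sup>2 * (1 - 1 / (8 * real k))\<^sup>2"
          using kk by (intro mult_left_mono zero_le_power2) (simp add: power2_eq_square field_simps)
        also have "\<dots> = q\<^sup>2" by (simp add: q_def power_mult_distrib)
        finally show ?thesis .
      qed
      ultimately show ?thesis by linarith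
    qed
    let ?X = "extremal_arcs C S R L a"
    have XV: "?X \<subseteq> (C \<union> L) \<times> (C \<union> L)" using S R a by (auto simp: extremal_arcs_def)
    have Xsym: "sym ?X" unfolding sym_def extremal_arcs_iff by blast
    \<comment> \<open>On \<open>L\<close> the values are chosen to satisfy the eigenvalue equation
      for \<open>\<rho>\<close> in the competitor; on \<open>C\<close> the vector \<open>x\<close>
      is kept.\<close>
    define z where "z v = (if v \<in> C then x v else if v = a then (s + r) / \<rho> else s / \<rho>)" for v
    have zC: "z v = x v" if "v \<in> C" for v using that by (simp add: z_def)
    have zsum: "sum z A = sum x A" if "A \<subseteq> C" for A using that zC by (intro sum.cong) auto
    have XL: "?X `` {v} = (if v = a then S \<union> R else S)" if "v \<in> L" for v
    proof -
      have "v \<notin> C" "v \<notin> S" "v \<notin> R" using that VCL S R by auto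
      then have "(v, w) \<in> ?X \<longleftrightarrow> w \<in> S \<or> v = a \<and> w \<in> R" for w
        using that unfolding extremal_arcs_iff by blast
      then show ?thesis by auto
    qed
    have XLC: "?X `` {v} \<inter> C = ?X `` {v}" if "v \<in> L" for v using XL[OF that] S R by auto
    have zL: "(\<Sum>w\<in>?X `` {v}. z w) = \<rho> * z v" if v: "v \<in> L" for v
    proof -
      have vC: "v \<notin> C" using v VCL by auto
      have "sum x (S \<union> R) = s + r" using R finS finR by (subst sum.union_disjoint) (auto simp: s_def r_def)
      then show ?thesis
        using zsum[of S] zsum[of "S \<union> R"] S R vC rho_bounds(3) by (auto simp: XL[OF v] z_def s_def)
    qed
    define Q where "Q = (\<Sum>(u, v)\<in>C \<times> C - Id_on C. x u * x v)"
    have "(\<Sum>(u, v)\<in>?X \<inter> C \<times> C. z u * z v) = Q"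
      unfolding Q_def extremal_arcs_Int_clique[OF VCL(2) a] by (intro sum.cong) (auto simp: zC)
    moreover have "(\<Sum>(u, v)\<in>?X. z u * z v) = (\<Sum>u\<in>C. z u * (\<Sum>v\<in>?X `` {u}. z v)) + (\<Sum>u\<in>L. z u * (\<Sum>v\<in>?X `` {u}. z v))"
      using sum_arcs[of "C \<union> L" ?X "\<lambda>u v. z u * z v"] XV finC finL VCL(2)
      by (simp add: sum.union_disjoint sum_distrib_left)
    moreover note sum_half_quadratic_form[OF finC finL VCL(2) XV Xsym, of z]
    ultimately have "(\<Sum>(u, v)\<in>?X. z u * z v) = Q + 2 * (\<Sum>v\<in>L. z v * (\<rho> * z v))"
      by (simp add: XLC zL)
    moreover have "(\<Sum>(u, v)\<in>?X. z u * z v) \<le> graph_spectral_radius (extremal_graph n k) * (\<Sum>v\<in>C \<union> L. (z v)\<^sup>2)"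
      by (rule rayleigh_extremal_arcs[OF finC finL S(1) R(1) VCL(2) a S(2) R(2) L(2) cCL k2 k3])
    moreover have "graph_spectral_radius (extremal_graph n k) * (\<Sum>v\<in>C \<union> L. (z v)\<^sup>2) \<le> \<rho> * (\<Sum>v\<in>C \<union> L. (z v)\<^sup>2)"
      using rho by (intro mult_right_mono sum_nonneg) auto
    moreover have "(\<Sum>v\<in>C \<union> L. (z v)\<^sup>2) = (\<Sum>v\<in>C. (x v)\<^sup>2) + (\<Sum>v\<in>L. (z v)\<^sup>2)"
      using sumV[of "\<lambda>v. (z v)\<^sup>2"] VCL(1) by (simp add: zC)
    moreover have "(\<Sum>v\<in>L. z v * (\<rho> * z v)) = \<rho> * (\<Sum>v\<in>L. (z v)\<^sup>2)"
      by (simp add: sum_distrib_left power2_eq_square algebra_simps)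
    \<comment> \<open>The arcs between \<open>C\<close> and \<open>L\<close> count twice in the
      form, giving \<open>2 * \<rho>\<close> times the squares on \<open>L\<close>. One half cancels
      against the norm on the right.\<close>
    ultimately have 1: "Q + \<rho> * (\<Sum>v\<in>L. (z v)\<^sup>2) \<le> \<rho> * (\<Sum>v\<in>C. (x v)\<^sup>2)"
      by (simp add: distrib_left)
    have EVCL: "E \<subseteq> (C \<union> L) \<times> (C \<union> L)" using EV VCL by simp
    \<comment> \<open>The same quantity is bounded above in the given graph: its arcs inside
      \<open>C\<close> are among those of \<open>Q\<close>, and dropping the arcs inside
      \<open>L\<close> only lowers the neighbour sums at \<open>L\<close>.\<close>
    have "\<rho> * (\<Sum>v\<in>C. (x v)\<^sup>2) = (\<Sum>u\<in>C. x u * (\<Sum>v\<in>E `` {u}. x v))"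
      using eigen VCL by (simp add: sum_distrib_left power2_eq_square algebra_simps)
    also have "\<dots> = (\<Sum>(u, v)\<in>E \<inter> C \<times> C. x u * x v) + (\<Sum>v\<in>L. x v * (\<Sum>u\<in>E `` {v} \<inter> C. x u))"
      by (rule sum_half_quadratic_form[OF finC finL VCL(2) EVCL symE])
    also have "\<dots> \<le> Q + (\<Sum>v\<in>L. x v * (\<rho> * x v))"
    proof (intro add_mono sum_mono mult_left_mono)
      have "E \<inter> C \<times> C \<subseteq> C \<times> C - Id_on C" using irrE by (auto simp: irrefl_def)
      then show "(\<Sum>(u, v)\<in>E \<inter> C \<times> C. x u * x v) \<le> Q"
        unfolding Q_def using finC posC by (intro sum_mono2) (auto intro: less_imp_le)
      fix v assume v: "v \<in> L"
      then show "0 \<le> x v" using x0 L by auto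
      have "(\<Sum>u\<in>E `` {v} \<inter> C. x u) \<le> (\<Sum>u\<in>E `` {v}. x u)"
        using finN x0 NV[of v] by (intro sum_mono2) auto
      then show "(\<Sum>u\<in>E `` {v} \<inter> C. x u) \<le> \<rho> * x v" using eigen v L by auto
    qed
    finally have "\<rho> * (\<Sum>v\<in>L. (z v)\<^sup>2) \<le> (\<Sum>v\<in>L. x v * (\<rho> * x v))" using 1 by linarith
    then have "\<rho> * (\<rho> * (\<Sum>v\<in>L. (z v)\<^sup>2)) \<le> \<rho> * (\<Sum>v\<in>L. x v * (\<rho> * x v))"
      using rho_bounds(3) by (intro mult_left_mono) auto
    then have 2: "(\<Sum>v\<in>L. (\<rho> * z v)\<^sup>2) \<le> (\<Sum>v\<in>L. (\<rho> * x v)\<^sup>2)"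
      by (simp add: sum_distrib_left power2_eq_square algebra_simps)
    have "(\<Sum>v\<in>L. (\<rho> * z v)\<^sup>2) = (\<rho> * z a)\<^sup>2 + (\<Sum>v\<in>L - {a}. (\<rho> * z v)\<^sup>2)"
      by (rule sum.remove[OF finL a])
    also have "(\<Sum>v\<in>L - {a}. (\<rho> * z v)\<^sup>2) = (\<Sum>v\<in>L - {a}. s\<^sup>2)"
      using VCL rho_bounds(3) by (intro sum.cong) (auto simp: z_def)
    also have "\<dots> = k * s\<^sup>2" using a L(2) finL by simp
    also have "\<rho> * z a = s + r" using a VCL rho_bounds(3) by (auto simp: z_def)
    finally have "(s + r)\<^sup>2 + k * s\<^sup>2 \<le> (\<Sum>v\<in>L. (\<rho> * x v)\<^sup>2)" using 2 by simp
    moreover have "(s + r)\<^sup>2 = s\<^sup>2 + 2 * s * r + r\<^sup>2" by (simp add: power2_eq_square algebra_simps)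
    ultimately have False using upper gap by (simp add: algebra_simps)
    then show ?thesis ..
  qed
qed

end

section \<open>From vertices of small degree to the factor\<close>

theorem theorem1p1:
  fixes G :: "'a pair_pre_digraph" and n k :: nat
  assumes "k \<ge> 2"
    and "even (k * n)"
    and "n \<ge> max (k\<^sup>2 + 6 * k + 7) (20 * k + 10)"
    and "pair_graph G"
    and "card (pverts G) = n"
    and "min_degree G \<ge> k"
    and "graph_spectral_radius G \<ge> graph_spectral_radius (extremal_graph n k)"
    and "\<not> digraph_iso G (extremal_graph n k)"
  shows "\<exists>H. is_factor k H G"
proof -
  note G = pair_graph_arcs[OF assms(4)]
  define V E where "V = pverts G" and "E = parcs G"
  define \<rho> where "\<rho> = graph_spectral_radius G"
  have n: "k\<^sup>2 + 6 * k + 7 \<le> n" "20 * k + 10 \<le> n" using assms(3) by auto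
  have "V \<noteq> {}" using assms(5) n by (auto simp: V_def)
  then obtain x where x: "\<forall>v\<in>V. 0 \<le> x v \<and> x v \<le> 1" "\<exists>v\<in>V. x v = 1"
    "\<forall>u\<in>V. (\<Sum>v\<in>E `` {u}. x v) = \<rho> * x u"
    using perron_vector[OF assms(4)] unfolding V_def E_def \<rho>_def by blast
  have min: "k \<le> card (E `` {v})" if "v \<in> V" for v
  proof -
    have "min_degree G \<le> out_degree G v"
      unfolding min_degree_def using G(1) that by (intro Min_le) (auto simp: V_def)
    then show ?thesis using assms(6) unfolding out_degree_eq_card_Image E_def by linarith
  qed
  have k3: "3 * k \<le> n" using n(2) by simp
  \<comment> \<open>The bound \<open>rho_ge\<close> is the clique bound for the extremal graph
    combined with the assumption on the spectral radii.\<close>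
  interpret perron_graph V E n k \<rho> x
    using G assms(1,5) n x min graph_spectral_radius_extremal_graph_ge[OF assms(1) k3] assms(7)
    by unfold_locales (auto simp: V_def E_def \<rho>_def)
  define L where "L = {v \<in> V. card (E `` {v}) \<le> 4 * k}"
  define U where "U = {u \<in> V - L. \<forall>v\<in>L. (v, u) \<in> E}"
  have L: "L \<subseteq> V" "card L \<le> k + 1" using card_very_low_degrees by (auto simp: L_def)
  \<comment> \<open>If the excess of \<open>L\<close> were insufficient, the spectral comparison
    would identify the graph with the excluded extremal one.\<close>
  have few: "card L \<le> k \<or> card L = k + 1 \<and> card U \<le> (\<Sum>v\<in>L. card (E `` {v}) - k)"
  proof (rule ccontr)
    assume "\<not> ?thesis"
    then have c: "card L = k + 1" "(\<Sum>v\<in>L. card (E `` {v}) - k) < card U" using L(2) by auto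
    obtain S R a where ext: "S \<subseteq> V - L" "R \<subseteq> V - L - S" "a \<in> L" "card S = k" "card R = k - 1"
      "E = extremal_arcs (V - L) S R L a"
      using few_excess_edges_extremal[OF L(1) c(1) U_def c(2)] assms(7) unfolding \<rho>_def by blast
    have finL: "finite L" using L(1) finV finite_subset by blast
    have "card (V - L) + card L = n"
      using card_mono[OF finV L(1)] card_Diff_subset[OF finL L(1)] cardV by simp
    moreover have "V = (V - L) \<union> L" using L(1) by auto
    ultimately have "digraph_iso G (extremal_graph n k)"
      using ext c(1) finV finL assms(1,4) k3
      by (intro digraph_iso_extremal_graphI[of G "V - L" L S R a]) (auto simp: V_def E_def)
    then show False using assms(8) by simp
  qed
  have "\<exists>F\<subseteq>E. sym F \<and> (\<forall>v\<in>V. card (F `` {v}) = k)"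
    by (rule regular_subgraph_of_few_low_degrees[OF finV EV symE irrE L(1) _ _ min few[unfolded U_def],
          where \<phi> = "\<lambda>v. card (E `` {v})"])
      (use assms(1,2) cardV L(1) degree_condition in \<open>auto simp: L_def[symmetric]\<close>)
  then obtain F where F: "F \<subseteq> E" "sym F" "\<And>v. v \<in> V \<Longrightarrow> card (F `` {v}) = k" by blast
  define H where "H = \<lparr>pverts = V, parcs = F\<rparr>"
  have H: "pair_graph H"
  proof
    show "finite (parcs H)" using F(1) EV finV by (auto simp: H_def intro: finite_subset[of F "V \<times> V"])
    show "symmetric H" using F(2) by (simp add: H_def symmetric_def arcs_ends_conv)
  next
    fix e assume "e \<in> parcs H"
    then have e: "(fst e, snd e) \<in> E" using F(1) by (auto simp: H_def)
    then show "fst e \<noteq> snd e" using irrE unfolding irrefl_def by metis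
    show "fst e \<in> pverts H" "snd e \<in> pverts H" using e EV by (auto simp: H_def)
  qed (use finV in \<open>simp add: H_def\<close>)
  have "regular_graph k H"
    using H F(3) unfolding regular_graph_def out_degree_eq_card_Image by (simp add: H_def)
  moreover have "spanning H G"
  proof -
    interpret G: pair_graph G by fact
    interpret H: pair_graph H by fact
    show ?thesis
      unfolding spanning_def subgraph_def compatible_def
      using F(1) G.wf_digraph_axioms H.wf_digraph_axioms by (auto simp: H_def V_def E_def)
  qed
  ultimately show ?thesis unfolding is_factor_def by blast
qed

end
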